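(* Consider a branching random walk $(V(u))_{u\in\mathbb{T}}$ as in the context. Assume that $$\mathbb{E}\Big[\sum_{|u|=1}e^{-V(u)}\Big]=1,$$ and that the real random variable $X$ whose law is given by $\int_{\mathbb{R}} f(x)\,\mathbf{P}_X(\mathrm{d}x)=\mathbb{E}\big[\sum_{|u|=1}f(V(u))e^{-V(u)}\big]$ for bounded measurable $f$ satisfies the following: there exist constants $\gamma>3$, $\alpha>1$, $x_0<0$ and a slowly varying function $\ell$ such that $$\mathtt{m}:=\mathbf{E}[X]>0,\qquad \mathbf{E}[(X^+)^\gamma]<\infty,\qquad \mathbf{P}(X\le x)=\int_{-\infty}^x|y|^{-\alpha-1}\ell(y)\,\mathrm{d}y\quad\text{for all }x\le x_0.$$ Let $\alpha_n:=(\alpha+1)\log n-\log\ell(n)$. Then there exists a constant $K>0$ such that for all integers $n\ge 2$ and all $x\ge 0$, $$\mathbb{P}(M_n\le \alpha_n-x)\le K e^{-x}.$$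
   Context: Branching random walk: under $\mathbb{P}$ (expectation $\mathbb{E}$), a particle sits at the origin; the displacements of its children form a point process $\mathcal{L}$ on $\mathbb{R}$; every particle of every generation has children whose displacements relative to its own position form an independent copy of $\mathcal{L}$, and so on. The genealogical tree is a Galton–Watson tree $\mathbb{T}$ with root $\varnothing$, assumed supercritical throughout. $|u|$ denotes the generation of $u\in\mathbb{T}$, $V(u)\in\mathbb{R}$ its position ($V(\varnothing)=0$). $M_n:=\min_{|u|=n}V(u)$, with $\inf\emptyset=\infty$. $\mathbf{P},\mathbf{E}$ denote probability and expectation on the space where $X$ is defined; $y^+=\max(y,0)$. The slowly varying function $\ell$ is given on $(-\infty,x_0]$ (slowly varying at $-\infty$), where $|x_0|$ is taken large enough that $\ell(x)>0$ for $x\le x_0$; it is extended to $\mathbb{R}$ by $\ell(x)=\ell(-x)$ for $x\ge|x_0|$ and $\ell(x)=1$ for $x\in(x_0,|x_0|)$. *)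

theory Defs
  imports "HOL-Probability.Probability"
begin

section \<open>Branching random walks\<close>

text \<open>
  Particles carry Ulam--Harris labels: the root is the empty word and the children of \<open>u\<close> are
  \<open>u @ [k]\<close> for \<open>k < N u \<omega>\<close>, where \<open>N u \<omega>\<close> may be infinite. The \<open>k\<close>-th child of \<open>u\<close> is displaced
  from \<open>u\<close> by \<open>D u k \<omega>\<close>, so the point process of \<open>u\<close> consists of the points \<open>D u k \<omega>\<close> with
  \<open>k < N u \<omega>\<close>, counted with multiplicity.
\<close>

definition gw_tree :: "(nat list \<Rightarrow> 'a \<Rightarrow> enat) \<Rightarrow> 'a \<Rightarrow> nat list set" where
  "gw_tree N \<omega> = {u. \<forall>i<length u. enat (u ! i) < N (take i u) \<omega>}"

definition generation :: "(nat list \<Rightarrow> 'a \<Rightarrow> enat) \<Rightarrow> nat \<Rightarrow> 'a \<Rightarrow> nat list set" where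
  "generation N n \<omega> = {u \<in> gw_tree N \<omega>. length u = n}"

definition position :: "(nat list \<Rightarrow> nat \<Rightarrow> 'a \<Rightarrow> real) \<Rightarrow> nat list \<Rightarrow> 'a \<Rightarrow> real" where
  "position D u \<omega> = (\<Sum>i<length u. D (take i u) (u ! i) \<omega>)"

text \<open>The infimum in the extended reals takes the value \<open>\<infinity>\<close> on an empty generation.\<close>

definition min_position ::
  "(nat list \<Rightarrow> 'a \<Rightarrow> enat) \<Rightarrow> (nat list \<Rightarrow> nat \<Rightarrow> 'a \<Rightarrow> real) \<Rightarrow> nat \<Rightarrow> 'a \<Rightarrow> ereal" where
  "min_position N D n \<omega> = (INF u\<in>generation N n \<omega>. ereal (position D u \<omega>))"

text \<open>
  The reproduction of \<open>u\<close>, that is, its number of children with the sequence of their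
  displacements. Entries without a child are overwritten by \<open>0\<close>, so that the values
  \<open>D u k \<omega>\<close> with \<open>k \<ge> N u \<omega>\<close> are irrelevant.
\<close>

definition reproduction ::
  "(nat list \<Rightarrow> 'a \<Rightarrow> enat) \<Rightarrow> (nat list \<Rightarrow> nat \<Rightarrow> 'a \<Rightarrow> real) \<Rightarrow> nat list \<Rightarrow> 'a \<Rightarrow> enat \<times> (nat \<Rightarrow> real)"
  where
  "reproduction N D u \<omega> = (N u \<omega>, \<lambda>k. if enat k < N u \<omega> then D u k \<omega> else 0)"

definition reproduction_space :: "(enat \<times> (nat \<Rightarrow> real)) measure" where
  "reproduction_space = count_space UNIV \<Otimes>\<^sub>M (\<Pi>\<^sub>M k\<in>UNIV. borel)"

locale branching_random_walk = prob_space M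
  for M :: "'a measure"
    and N :: "nat list \<Rightarrow> 'a \<Rightarrow> enat"
    and D :: "nat list \<Rightarrow> nat \<Rightarrow> 'a \<Rightarrow> real" +
  assumes indep_reproduction:
      "indep_vars (\<lambda>_. reproduction_space) (reproduction N D) UNIV"
    and same_law_reproduction:
      "distr M reproduction_space (reproduction N D u) =
       distr M reproduction_space (reproduction N D [])"

definition supercritical :: "'a measure \<Rightarrow> (nat list \<Rightarrow> 'a \<Rightarrow> enat) \<Rightarrow> bool" where
  "supercritical M N \<longleftrightarrow> (\<integral>\<^sup>+ \<omega>. ennreal_of_enat (N [] \<omega>) \<partial>M) > 1"

section \<open>Slowly varying functions on a negative half-line\<close>

definition slowly_varying_at_bot :: "real \<Rightarrow> (real \<Rightarrow> real) \<Rightarrow> bool" where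
  "slowly_varying_at_bot x0 l \<longleftrightarrow>
     set_borel_measurable borel {..x0} l \<and>
     (\<forall>c>0. ((\<lambda>x. l (c * x) / l x) \<longlongrightarrow> 1) at_bot)"

text \<open>Only the values of \<open>l\<close> on \<open>(-\<infinity>, x0]\<close> enter; \<open>x0\<close> is meant to be negative.\<close>

definition extend :: "real \<Rightarrow> (real \<Rightarrow> real) \<Rightarrow> real \<Rightarrow> real" where
  "extend x0 l x = (if x \<le> x0 then l x else if \<bar>x0\<bar> \<le> x then l (- x) else 1)"

definition alpha_seq :: "real \<Rightarrow> (real \<Rightarrow> real) \<Rightarrow> nat \<Rightarrow> real" where
  "alpha_seq \<alpha> l n = (\<alpha> + 1) * ln (real n) - ln (l (real n))"

end

theory Submission
  imports Defs
begin

text \<open>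
  Let \<open>q k v = exp (- v) * P(some particle of generation k lies at or below v)\<close>. A union bound over the
  first generation, followed by the change of measure that defines \<open>X\<close>, gives
  \<open>q (k + 1) v \<le> E [q k (v - X)]\<close> (\<open>discounted_reach_prob_step\<close>), while trivially \<open>q k v \<le> 1\<close> and
  \<open>q k v \<le> exp (- v)\<close>. These inequalities reduce the tree to the steps of a random walk.

  Let \<open>\<Phi> s = s powr (- \<alpha> - 1) * l (- s)\<close> be the density of a downward jump of size \<open>s\<close>. As
  \<open>exp (- \<alpha>\<^sub>n) = \<Phi> n\<close> for large \<open>n\<close>, the theorem says that \<open>q n v \<le> K * \<Phi> n\<close> for levels \<open>v\<close> up to about
  \<open>\<alpha>\<^sub>n\<close>. It follows from the stronger bound \<open>q k v \<le> K * G (c k - v)\<close> for all \<open>k\<close> and all \<open>v < c k\<close>, where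
  \<open>0 < c < E X\<close> and \<open>G\<close> is comparable to \<open>\<Phi>\<close>; note that \<open>\<alpha>\<^sub>n\<close> is of order \<open>ln n\<close>, so that \<open>c n - v\<close> is
  at least of order \<open>n\<close> there. The bound is proved by induction on \<open>k\<close> (\<open>one_big_jump_bound\<close>). One step
  moves \<open>s = c k - v\<close> to \<open>s - c + X\<close>, which has positive drift; so as long as the step does not bring \<open>s\<close>
  below \<open>s / 2\<close>, the decreasing function \<open>G\<close> does not increase in mean. A longer jump has a density of
  order \<open>G s\<close>, and it helps only if it lands where \<open>q k\<close> is not small: this costs
  \<open>G s * \<integral> q k (u) du\<close>. The integrand is small for large \<open>u\<close> because of \<open>exp (- u)\<close>, and for very negative \<open>u\<close> by
  the induction hypothesis, so the integral is summable over \<open>k\<close> because \<open>\<alpha> > 1\<close>.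

  The function \<open>G\<close> is a lower envelope of power functions (\<open>power_envelope\<close>). For powers the
  supermartingale property is a computation (\<open>nn_integral_shifted_power_le\<close>), it survives the infimum,
  and \<open>potter_bound\<close> makes the envelope comparable to \<open>\<Phi>\<close>.
\<close>

section \<open>Slowly varying functions\<close>

text \<open>
  Karamata's uniform convergence theorem in additive form. By dominated convergence, the set of
  \<open>w \<in> [0, 2]\<close> with a large increment from \<open>x\<close> to \<open>x + w\<close> has small measure once \<open>x\<close> is large. This
  applies to the base point \<open>x + u\<close> as well, so some point of the interval \<open>[x + 1, x + 2]\<close>, which
  both windows share, has a small increment from \<open>x\<close> and from \<open>x + u\<close>. Hence \<open>h (x + u) - h x\<close> is
  small.
\<close>

lemma slow_variation_uniform_increments:
  fixes h :: "real \<Rightarrow> real"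
  assumes h[measurable]: "h \<in> borel_measurable borel"
    and lim: "\<And>u. ((\<lambda>x. h (x + u) - h x) \<longlongrightarrow> 0) at_top"
    and "e > 0"
  shows "\<exists>X. \<forall>x\<ge>X. \<forall>u\<in>{0..1}. \<bar>h (x + u) - h x\<bar> \<le> e"
proof -
  define s :: "real \<Rightarrow> real \<Rightarrow> real" where
    "s x w = indicator {0..2} w * (if \<bar>h (x + w) - h x\<bar> \<ge> e / 2 then 1 else 0)" for x w
  have s_meas[measurable]: "s x \<in> borel_measurable borel" for x
    unfolding s_def by measurable
  have dom: "integrable lborel (indicator {0..2::real} :: real \<Rightarrow> real)"
    by simp
  have s_int: "integrable lborel (s x)" for x
    by (rule Bochner_Integration.integrable_bound[OF dom]) (auto simp: s_def indicator_def)
  have "((\<lambda>x. integral\<^sup>L lborel (s x)) \<longlongrightarrow> integral\<^sup>L lborel (\<lambda>_::real. 0::real)) at_top"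
  proof (rule integral_dominated_convergence_at_top[OF _ _ dom])
    show "AE w in lborel. ((\<lambda>x. s x w) \<longlongrightarrow> 0) at_top"
    proof (rule AE_I2)
      fix w :: real
      have "eventually (\<lambda>x. \<bar>h (x + w) - h x\<bar> < e / 2) at_top"
        using tendstoD[OF lim[of w], of "e / 2"] \<open>e > 0\<close> by (simp add: dist_real_def)
      then have "eventually (\<lambda>x. s x w = 0) at_top"
        by eventually_elim (simp add: s_def)
      then show "((\<lambda>x. s x w) \<longlongrightarrow> 0) at_top"
        by (rule tendsto_eventually)
    qed
  qed (auto simp: s_def indicator_def intro!: always_eventually)
  then have "((\<lambda>x. integral\<^sup>L lborel (s x)) \<longlongrightarrow> 0) at_top"
    by simp
  from order_tendstoD(2)[OF this, of "1/2"] obtain X where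
    X: "\<And>x. x \<ge> X \<Longrightarrow> integral\<^sup>L lborel (s x) < 1 / 2"
    by (auto simp: eventually_at_top_linorder)
  have "\<bar>h (x + u) - h x\<bar> \<le> e" if x: "x \<ge> X" and u: "u \<in> {0..1}" for x u
  proof (rule ccontr)
    assume far: "\<not> \<bar>h (x + u) - h x\<bar> \<le> e"
    \<comment> \<open>If the increment over [x, x + u] exceeds e, each point of [x + 1, x + 2] is far from x or from x + u.\<close>
    have cover: "indicator {1..2} w \<le> s x w + s (x + u) (w - u)" for w
    proof (cases "w \<in> {1..2}")
      case True
      then have "w - u \<in> {0..2}" "w \<in> {0..2}"
        using u by auto
      moreover have "\<bar>h (x + w) - h x\<bar> \<ge> e / 2 \<or> \<bar>h (x + u + (w - u)) - h (x + u)\<bar> \<ge> e / 2"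
      proof -
        have "x + u + (w - u) = x + w"
          by simp
        then show ?thesis
          using far by argo
      qed
      ultimately show ?thesis
        by (auto simp: s_def indicator_def)
    qed (auto simp: s_def)
    have shift: "integrable lborel (\<lambda>w. s (x + u) (w - u))"
      "integral\<^sup>L lborel (\<lambda>w. s (x + u) (w - u)) = integral\<^sup>L lborel (s (x + u))"
      using lborel_integrable_real_affine[OF s_int[of "x + u"], of 1 "- u"]
        lborel_integral_real_affine[of 1 "s (x + u)" "- u"] by simp_all
    have "(1::real) = integral\<^sup>L lborel (indicator {1..2::real})"
      by simp
    also have "\<dots> \<le> integral\<^sup>L lborel (\<lambda>w. s x w + s (x + u) (w - u))"
      by (rule integral_mono) (use cover s_int shift in auto)
    also have "\<dots> = integral\<^sup>L lborel (s x) + integral\<^sup>L lborel (s (x + u))"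
      using s_int shift by simp
    also have "\<dots> < 1"
      using X[of x] X[of "x + u"] x u by auto
    finally show False
      by simp
  qed
  then show ?thesis
    by blast
qed

text \<open>
  Unit steps are chained; an increment over the length \<open>u\<close> takes at most \<open>u + 1\<close> of them.
\<close>

lemma slow_variation_linear_increments:
  fixes h :: "real \<Rightarrow> real"
  assumes "\<forall>x\<ge>X. \<forall>u\<in>{0..1}. \<bar>h (x + u) - h x\<bar> \<le> e" and "e \<ge> 0" and "x \<ge> X" and "u \<ge> 0"
  shows "\<bar>h (x + u) - h x\<bar> \<le> e * (u + 1)"
proof -
  have *: "\<bar>h (x + u) - h x\<bar> \<le> e * real n" if "0 \<le> u" "u \<le> real n" "x \<ge> X" for n x u
    using that
  proof (induction n arbitrary: x u)
    case (Suc n)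
    define t where "t = min u 1"
    have "\<bar>h (x + t) - h x\<bar> \<le> e"
      using assms(1) Suc.prems by (auto simp: t_def)
    moreover have "\<bar>h (x + t + (u - t)) - h (x + t)\<bar> \<le> e * real n"
      by (rule Suc.IH) (use Suc.prems in \<open>auto simp: t_def\<close>)
    ultimately show ?case
      by (auto simp: algebra_simps)
  qed auto
  have "\<bar>h (x + u) - h x\<bar> \<le> e * real (nat \<lceil>u\<rceil>)"
    by (rule *) (use assms in auto)
  also have "\<dots> \<le> e * (u + 1)"
    using assms of_int_ceiling_le_add_one[of u] by (intro mult_left_mono) auto
  finally show ?thesis .
qed

text \<open>
  Passing to \<open>h x = ln (l (- exp x))\<close> turns multiplication of the argument into translation, and
  increments of \<open>h\<close> of size at most \<open>e (u + 1)\<close> into the factors \<open>exp e\<close> and \<open>(s / y) powr (\<plusminus>e)\<close>.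
  The sum of the two powers dominates whichever of them is the larger one.
\<close>

lemma potter_bound:
  assumes sv: "slowly_varying_at_bot x0 l" and x0: "x0 < 0"
    and pos: "\<And>x. x \<le> x0 \<Longrightarrow> l x > 0" and e: "e > 0"
  shows "\<exists>Y\<ge>1. - x0 \<le> Y \<and>
    (\<forall>s\<ge>Y. \<forall>y\<ge>Y. l (- s) \<le> exp e * l (- y) * ((s / y) powr e + (s / y) powr (- e)))"
proof -
  have meas: "set_borel_measurable borel {..x0} l"
    and lim: "\<And>c. c > 0 \<Longrightarrow> ((\<lambda>x. l (c * x) / l x) \<longlongrightarrow> 1) at_bot"
    using sv by (auto simp: slowly_varying_at_bot_def)
  have l_meas[measurable]: "(\<lambda>x. indicator {..x0} x * l x) \<in> borel_measurable borel"
    using meas by (simp add: set_borel_measurable_def)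
  \<comment> \<open>The indicator makes h measurable on the whole line; it is 1 for large x.\<close>
  define h where "h x = ln (indicator {..x0} (- exp x) * l (- exp x))" for x :: real
  have h_eq: "h x = ln (l (- exp x))" if "x \<ge> ln (- x0)" for x
  proof -
    have "- x0 \<le> exp x"
      using that x0 by (metis exp_le_cancel_iff exp_ln neg_0_less_iff_less)
    then show ?thesis
      by (simp add: h_def)
  qed
  have "(\<lambda>x::real. - exp x) \<in> borel_measurable borel"
    by simp
  from measurable_compose[OF this l_meas]
  have h_meas: "h \<in> borel_measurable borel"
    unfolding h_def by simp
  have h_lim: "((\<lambda>x. h (x + u) - h x) \<longlongrightarrow> 0) at_top" for u
  proof -
    have bot: "filterlim (\<lambda>x::real. - exp x) at_bot at_top"
      by (intro filterlim_compose[OF filterlim_uminus_at_bot_at_top] exp_at_top)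
    have "((\<lambda>x. l (exp u * - exp x) / l (- exp x)) \<longlongrightarrow> 1) at_top"
      using filterlim_compose[OF lim[of "exp u"] bot] by simp
    then have "((\<lambda>x. ln (l (exp u * - exp x) / l (- exp x))) \<longlongrightarrow> ln 1) at_top"
      by (intro tendsto_ln) auto
    moreover have "eventually (\<lambda>x. ln (l (exp u * - exp x) / l (- exp x)) = h (x + u) - h x) at_top"
      using eventually_ge_at_top[of "max (ln (- x0)) (ln (- x0) - u)"]
    proof eventually_elim
      case (elim x)
      then have "x \<ge> ln (- x0)" "x + u \<ge> ln (- x0)"
        by auto
      moreover from this have "exp x \<ge> - x0" "exp (x + u) \<ge> - x0"
        using x0 by (metis exp_le_cancel_iff exp_ln neg_0_less_iff_less)+
      then have "l (- exp x) > 0" "l (- exp (x + u)) > 0"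
        by (auto intro!: pos)
      ultimately show ?case
        by (simp add: h_eq ln_div exp_add mult.commute)
    qed
    ultimately show ?thesis
      using tendsto_cong by force
  qed
  obtain X where X: "\<forall>x\<ge>X. \<forall>u\<in>{0..1}. \<bar>h (x + u) - h x\<bar> \<le> e"
    using slow_variation_uniform_increments[OF h_meas h_lim e] by blast
  define Y where "Y = Max {1, - x0, exp X}"
  have Y: "Y \<ge> 1" "- x0 \<le> Y" "exp X \<le> Y"
    by (auto simp: Y_def)
  have "l (- s) \<le> exp e * l (- y) * ((s / y) powr e + (s / y) powr (- e))"
    if s: "s \<ge> Y" and y: "y \<ge> Y" for s y
  proof -
    have sy: "s > 0" "y > 0" "l (- s) > 0" "l (- y) > 0"
      using s y Y by (auto intro!: pos)
    have lnX: "ln t \<ge> X" "ln t \<ge> ln (- x0)" "t > 0" if "t \<ge> Y" for t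
      using that Y x0 by (auto simp: ln_ge_iff)
    have hl: "h (ln t) = ln (l (- t))" if "t \<ge> Y" for t
      using h_eq[of "ln t"] lnX[OF that] by simp
    have d: "ln (l (- s)) - ln (l (- y)) \<le> e + e * \<bar>ln s - ln y\<bar>"
    proof (cases "s \<ge> y")
      case True
      then have ge: "ln s - ln y \<ge> 0"
        using sy by simp
      from slow_variation_linear_increments[OF X _ lnX(1)[OF y] this] e
      have "\<bar>ln (l (- s)) - ln (l (- y))\<bar> \<le> e * (ln s - ln y + 1)"
        by (simp add: hl s y)
      with ge show ?thesis
        by (simp add: algebra_simps)
    next
      case False
      then have ge: "ln y - ln s \<ge> 0"
        using sy by simp
      from slow_variation_linear_increments[OF X _ lnX(1)[OF s] this] e
      have "\<bar>ln (l (- y)) - ln (l (- s))\<bar> \<le> e * (ln y - ln s + 1)"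
        by (simp add: hl s y)
      with ge show ?thesis
        by (simp add: algebra_simps)
    qed
    have "l (- s) = exp (ln (l (- s)))"
      using sy by simp
    also have "\<dots> \<le> exp (e + ln (l (- y)) + e * \<bar>ln s - ln y\<bar>)"
      using d by simp
    also have "\<dots> = exp e * l (- y) * exp (e * \<bar>ln s - ln y\<bar>)"
      using sy by (simp add: exp_add)
    also have "exp (e * \<bar>ln s - ln y\<bar>) \<le> (s / y) powr e + (s / y) powr (- e)"
      using sy by (auto simp: powr_def ln_div abs_if algebra_simps)
    finally show ?thesis
      using sy by simp
  qed
  with Y show ?thesis
    by blast
qed

section \<open>Envelopes of powers along a walk with positive drift\<close>

text \<open>
  A regularly varying function \<open>f\<close> need not have any smoothness, so there is no Taylor expansion of
  \<open>f (s + x)\<close>. Its envelope by sums of two pure powers that exceed \<open>f\<close>, up to a constant, replaces it: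
  Potter's bound makes the envelope comparable to \<open>f\<close>, and any inequality \<open>E g(s + \<xi>) \<le> g(s)\<close> that
  holds for both powers passes to the infimum.
\<close>

definition power_envelope :: "(real \<Rightarrow> real) \<Rightarrow> real \<Rightarrow> real \<Rightarrow> real \<Rightarrow> real \<Rightarrow> real" where
  "power_envelope f Y b1 b2 s = (INF y\<in>{Y..}. f y * ((s / y) powr (- b1) + (s / y) powr (- b2)))"

context
  fixes f :: "real \<Rightarrow> real" and Y b1 b2 :: real
  assumes Y: "Y > 0" and f_pos: "\<And>y. y \<ge> Y \<Longrightarrow> f y > 0" and b: "0 < b1" "b1 \<le> b2"
begin

lemma bdd_below_power_envelope:
  "bdd_below ((\<lambda>y. f y * ((s / y) powr (- b1) + (s / y) powr (- b2))) ` {Y..})"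
  by (rule bdd_belowI2[of _ 0]) (auto intro!: mult_nonneg_nonneg simp: less_imp_le[OF f_pos])

lemma power_envelope_le:
  "y \<ge> Y \<Longrightarrow> power_envelope f Y b1 b2 s \<le> f y * ((s / y) powr (- b1) + (s / y) powr (- b2))"
  unfolding power_envelope_def by (rule cINF_lower[OF bdd_below_power_envelope]) simp

lemma le_power_envelope:
  assumes "\<And>y. y \<ge> Y \<Longrightarrow> a \<le> f y * ((s / y) powr (- b1) + (s / y) powr (- b2))"
  shows "a \<le> power_envelope f Y b1 b2 s"
  unfolding power_envelope_def by (rule cINF_greatest) (use assms in auto)

lemma power_envelope_antimono:
  assumes "0 < s" "s \<le> t"
  shows "power_envelope f Y b1 b2 t \<le> power_envelope f Y b1 b2 s"
proof (rule le_power_envelope)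
  fix y assume y: "y \<ge> Y"
  have "(t / y) powr (- a) \<le> (s / y) powr (- a)" if "a \<ge> 0" for a
    using that assms y Y by (intro powr_mono2') (auto intro: divide_right_mono)
  then have "f y * ((t / y) powr (- b1) + (t / y) powr (- b2)) \<le> f y * ((s / y) powr (- b1) + (s / y) powr (- b2))"
    using f_pos[OF y] b by (intro mult_left_mono add_mono) auto
  with power_envelope_le[OF y, of t]
  show "power_envelope f Y b1 b2 t \<le> f y * ((s / y) powr (- b1) + (s / y) powr (- b2))"
    by linarith
qed

text \<open>
  Each member of the family grows at most by \<open>\<kappa> powr (- b2)\<close>, the larger of the two factors.
\<close>

lemma power_envelope_scale:
  assumes "0 < \<kappa>" "\<kappa> \<le> 1" "s > 0"
  shows "power_envelope f Y b1 b2 (\<kappa> * s) \<le> \<kappa> powr (- b2) * power_envelope f Y b1 b2 s"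
proof -
  have "power_envelope f Y b1 b2 (\<kappa> * s) / \<kappa> powr (- b2) \<le> power_envelope f Y b1 b2 s"
  proof (rule le_power_envelope)
    fix y assume y: "y \<ge> Y"
    have "\<kappa> powr (- b1) \<le> \<kappa> powr (- b2)"
      using assms b by (intro powr_mono') auto
    then have "(\<kappa> * s / y) powr (- b1) + (\<kappa> * s / y) powr (- b2)
        \<le> \<kappa> powr (- b2) * ((s / y) powr (- b1) + (s / y) powr (- b2))"
      using assms y Y
      by (simp add: powr_mult powr_divide distrib_left divide_right_mono mult_right_mono)
    with power_envelope_le[OF y, of "\<kappa> * s"] f_pos[OF y]
    have "power_envelope f Y b1 b2 (\<kappa> * s)
        \<le> f y * (\<kappa> powr (- b2) * ((s / y) powr (- b1) + (s / y) powr (- b2)))"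
      by (meson less_imp_le mult_left_mono order_trans)
    then show "power_envelope f Y b1 b2 (\<kappa> * s) / \<kappa> powr (- b2)
        \<le> f y * ((s / y) powr (- b1) + (s / y) powr (- b2))"
      using assms by (simp add: divide_le_eq mult_ac)
  qed
  then show ?thesis
    using assms by (simp add: divide_le_eq mult_ac)
qed

lemma power_envelope_ge:
  assumes "C > 0" "s \<ge> Y"
    and potter: "\<And>y. y \<ge> Y \<Longrightarrow> f s \<le> C * f y * ((s / y) powr (- b1) + (s / y) powr (- b2))"
  shows "f s / C \<le> power_envelope f Y b1 b2 s"
  by (rule le_power_envelope) (use assms in \<open>auto simp: divide_le_eq mult_ac\<close>)

text \<open>
  The member with \<open>y = Y\<close> gives the bound; away from \<open>0\<close> the power \<open>s powr (- b2)\<close> is dominated by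
  \<open>s powr (- b1)\<close>.
\<close>

lemma power_envelope_power_bound:
  "\<exists>C>0. \<forall>s\<ge>1 / 2. power_envelope f Y b1 b2 s \<le> C * s powr (- b1)"
proof (intro exI conjI allI impI)
  let ?C = "f Y * (Y powr b1 + Y powr b2 * (1 / 2) powr (b1 - b2))"
  show "?C > 0"
    using f_pos[of Y] Y by (intro mult_pos_pos add_pos_pos) auto
  fix s :: real assume s: "s \<ge> 1 / 2"
  have "(s / Y) powr (- b2) = Y powr b2 * s powr (- b2)"
    using s Y by (simp add: powr_divide powr_minus field_simps)
  also have "s powr (- b2) = s powr (b1 - b2) * s powr (- b1)"
    by (simp flip: powr_add)
  also have "s powr (b1 - b2) \<le> (1 / 2) powr (b1 - b2)"
    using s b by (intro powr_mono2') auto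
  finally have *: "(s / Y) powr (- b2) \<le> Y powr b2 * (1 / 2) powr (b1 - b2) * s powr (- b1)"
    using Y by (simp add: mult_ac mult_left_mono mult_right_mono)
  have "(s / Y) powr (- b1) = Y powr b1 * s powr (- b1)"
    using s Y by (simp add: powr_divide powr_minus field_simps)
  with * have "f Y * ((s / Y) powr (- b1) + (s / Y) powr (- b2)) \<le> ?C * s powr (- b1)"
    using f_pos[of Y] by (simp add: distrib_left distrib_right mult.assoc mult_left_mono)
  with power_envelope_le[of Y s] show "power_envelope f Y b1 b2 s \<le> ?C * s powr (- b1)"
    by simp
qed

text \<open>
  The supermartingale property of the two powers is inherited by each member of the family, hence by
  the infimum.
\<close>

lemma nn_integral_power_envelope_le:
  assumes p1: "(\<integral>\<^sup>+x. ennreal ((s - c + x) powr (- b1)) * indicator A x \<partial>\<mu>) \<le> ennreal (s powr (- b1))"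
    and p2: "(\<integral>\<^sup>+x. ennreal ((s - c + x) powr (- b2)) * indicator A x \<partial>\<mu>) \<le> ennreal (s powr (- b2))"
    and \<mu>: "sets \<mu> = sets borel" and A: "A \<in> sets borel" and "s > 0" and A_pos: "\<And>x. x \<in> A \<Longrightarrow> s - c + x > 0"
  shows "(\<integral>\<^sup>+x. ennreal (power_envelope f Y b1 b2 (s - c + x)) * indicator A x \<partial>\<mu>)
    \<le> ennreal (power_envelope f Y b1 b2 s)" (is "?I \<le> _")
proof -
  note [measurable_cong] = \<mu>
  note [measurable] = A
  have le: "?I \<le> ennreal (f y * ((s / y) powr (- b1) + (s / y) powr (- b2)))" if y: "y \<ge> Y" for y
  proof -
    have y0: "y > 0"
      using y Y by simp
    have f0: "f y > 0"
      by (rule f_pos[OF y])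
    have "?I \<le> (\<integral>\<^sup>+x. ennreal (f y * y powr b1) * (ennreal ((s - c + x) powr (- b1)) * indicator A x)
        + ennreal (f y * y powr b2) * (ennreal ((s - c + x) powr (- b2)) * indicator A x) \<partial>\<mu>)"
    proof (rule nn_integral_mono)
      fix x
      show "ennreal (power_envelope f Y b1 b2 (s - c + x)) * indicator A x \<le>
        ennreal (f y * y powr b1) * (ennreal ((s - c + x) powr (- b1)) * indicator A x)
        + ennreal (f y * y powr b2) * (ennreal ((s - c + x) powr (- b2)) * indicator A x)"
      proof (cases "x \<in> A")
        case True
        define z where "z = s - c + x"
        have z: "z > 0"
          using A_pos[OF True] by (simp add: z_def)
        have "power_envelope f Y b1 b2 z \<le> f y * ((z / y) powr (- b1) + (z / y) powr (- b2))"
          by (rule power_envelope_le[OF y])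
        also have "\<dots> = f y * y powr b1 * z powr (- b1) + f y * y powr b2 * z powr (- b2)"
          using z y0 by (simp add: powr_divide powr_minus field_simps)
        finally have "ennreal (power_envelope f Y b1 b2 z)
            \<le> ennreal (f y * y powr b1 * z powr (- b1) + f y * y powr b2 * z powr (- b2))"
          by (rule ennreal_leI)
        also have "\<dots> = ennreal (f y * y powr b1) * ennreal (z powr (- b1)) + ennreal (f y * y powr b2) * ennreal (z powr (- b2))"
          using f0 by (subst ennreal_plus) (auto simp: ennreal_mult)
        finally show ?thesis
          using True by (simp add: z_def)
      qed simp
    qed
    also have "\<dots> = ennreal (f y * y powr b1) * (\<integral>\<^sup>+x. ennreal ((s - c + x) powr (- b1)) * indicator A x \<partial>\<mu>)
        + ennreal (f y * y powr b2) * (\<integral>\<^sup>+x. ennreal ((s - c + x) powr (- b2)) * indicator A x \<partial>\<mu>)"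
      by (subst nn_integral_add; (subst nn_integral_cmult)?) (measurable, simp add: nn_integral_cmult)
    also have "\<dots> \<le> ennreal (f y * y powr b1) * ennreal (s powr (- b1)) + ennreal (f y * y powr b2) * ennreal (s powr (- b2))"
      by (intro add_mono mult_left_mono p1 p2) auto
    also have "\<dots> = ennreal (f y * ((s / y) powr (- b1) + (s / y) powr (- b2)))"
      using f0 y0 \<open>s > 0\<close>
      by (simp add: powr_divide powr_minus field_simps flip: ennreal_mult ennreal_plus)
    finally show ?thesis .
  qed
  then have "?I < top"
    using le[of Y] by (meson ennreal_less_top le_less_trans order_refl)
  then obtain a where a: "?I = ennreal a" "a \<ge> 0"
    by (metis ennreal_cases infinity_ennreal_def less_irrefl)
  have "a \<le> power_envelope f Y b1 b2 s"
  proof (rule le_power_envelope)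
    fix y assume y: "y \<ge> Y"
    have "0 \<le> f y * ((s / y) powr (- b1) + (s / y) powr (- b2))"
      using f_pos[OF y] by simp
    with le[OF y] show "a \<le> f y * ((s / y) powr (- b1) + (s / y) powr (- b2))"
      unfolding a by (simp add: ennreal_le_iff)
  qed
  then show ?thesis
    unfolding a by (rule ennreal_leI)
qed

end

text \<open>
  Under one step, \<open>s\<close> moves to \<open>s - c + X\<close>, with positive drift \<open>E X - c\<close>. By dominated convergence
  \<open>s * E [(1 + (X - c) / s) powr (- b) - 1; X \<ge> c - s / 2]\<close> tends to \<open>- b (E X - c) < 0\<close>.
  Cutting off the steps below \<open>c - s / 2\<close> keeps the difference quotient bounded by a multiple of
  \<open>\<bar>X - c\<bar>\<close>, which is integrable.
\<close>

lemma nn_integral_shifted_power_le: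
  fixes \<mu> :: "real measure"
  assumes "prob_space \<mu>" and \<mu>: "sets \<mu> = sets borel"
    and int: "integrable \<mu> (\<lambda>x. x)" and c: "c < (\<integral>x. x \<partial>\<mu>)" and b: "b > 0"
  shows "\<exists>s0>0. \<forall>s\<ge>s0. (\<integral>\<^sup>+x. ennreal ((s - c + x) powr (- b)) * indicator {c - s / 2..} x \<partial>\<mu>)
    \<le> ennreal (s powr (- b))"
proof -
  interpret prob_space \<mu> by fact
  note [measurable_cong] = \<mu>
  define F where "F s x = s * ((1 + (x - c) / s) powr (- b) - 1) * indicator {c - s / 2..} x"
    for s x :: real
  have F_meas[measurable]: "F s \<in> borel_measurable \<mu>" for s
    unfolding F_def by measurable
  \<comment> \<open>B bounds the derivative of (1 + t) powr (- b) on t >= - 1 / 2.\<close>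
  define B where "B = b * (1 / 2) powr (- b - 1)"
  have int_c: "integrable \<mu> (\<lambda>x. x - c)"
    using int by simp
  have bound: "\<bar>F s x\<bar> \<le> B * \<bar>x - c\<bar>" if s: "s > 0" for s x
  proof (cases "x \<ge> c - s / 2")
    case True
    define t where "t = (x - c) / s"
    have t: "t \<in> {- 1 / 2..}"
      using True s by (simp add: t_def field_simps)
    have "norm ((1 + t) powr (- b) - (1 + 0) powr (- b)) \<le> B * norm (t - 0)"
    proof (rule field_differentiable_bound[of "{- 1 / 2..}"])
      fix z :: real assume z: "z \<in> {- 1 / 2..}"
      show "((\<lambda>t. (1 + t) powr (- b)) has_field_derivative (- b * (1 + z) powr (- b - 1))) (at z within {- 1 / 2..})"
        using z by (auto intro!: derivative_eq_intros)
      have "(1 + z) powr (- b - 1) \<le> (1 / 2) powr (- b - 1)"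
        using z b by (intro powr_mono2') auto
      then show "norm (- b * (1 + z) powr (- b - 1)) \<le> B"
        using b by (simp add: B_def abs_mult)
    qed (use t in auto)
    then have "s * \<bar>(1 + t) powr (- b) - 1\<bar> \<le> s * (B * \<bar>t\<bar>)"
      using s by (intro mult_left_mono) auto
    also have "\<dots> = B * \<bar>x - c\<bar>"
      using s by (simp add: t_def abs_divide)
    finally show ?thesis
      using s True by (simp add: F_def t_def abs_mult)
  next
    case False
    then show ?thesis
      using b by (simp add: F_def B_def)
  qed
  have F_lim: "((\<lambda>s. F s x) \<longlongrightarrow> - b * (x - c)) at_top" for x
  proof -
    have "((\<lambda>t. (1 + t * (x - c)) powr (- b)) has_field_derivative (- b * (x - c))) (at 0)"
      by (auto intro!: derivative_eq_intros)
    then have "((\<lambda>t. ((1 + t * (x - c)) powr (- b) - 1) / t) \<longlongrightarrow> - b * (x - c)) (at 0)"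
      by (simp add: DERIV_def)
    then have "((\<lambda>t. ((1 + t * (x - c)) powr (- b) - 1) / t) \<longlongrightarrow> - b * (x - c)) (at_right 0)"
      by (rule tendsto_mono[rotated]) (simp add: at_le)
    from filterlim_compose[OF this filterlim_inverse_at_right_top]
    have "((\<lambda>s. ((1 + inverse s * (x - c)) powr (- b) - 1) / inverse s) \<longlongrightarrow> - b * (x - c)) at_top" .
    moreover have "eventually (\<lambda>s. ((1 + inverse s * (x - c)) powr (- b) - 1) / inverse s = F s x) at_top"
      using eventually_gt_at_top[of "max 0 (2 * (c - x))"]
      by eventually_elim (auto simp: F_def field_simps)
    ultimately show ?thesis
      using tendsto_cong by force
  qed
  have "((\<lambda>s. integral\<^sup>L \<mu> (F s)) \<longlongrightarrow> (\<integral>x. - b * (x - c) \<partial>\<mu>)) at_top"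
  proof (rule integral_dominated_convergence_at_top[where w = "\<lambda>x. B * \<bar>x - c\<bar>"])
    show "integrable \<mu> (\<lambda>x. B * \<bar>x - c\<bar>)"
      using int_c by simp
    show "\<forall>\<^sub>F s in at_top. AE x in \<mu>. norm (F s x) \<le> B * \<bar>x - c\<bar>"
      using eventually_gt_at_top[of 0] by eventually_elim (use bound in auto)
  qed (use F_lim in auto)
  moreover have "(\<integral>x. - b * (x - c) \<partial>\<mu>) < 0"
    using int c b by (simp add: prob_space mult_less_0_iff)
  ultimately have "eventually (\<lambda>s. integral\<^sup>L \<mu> (F s) < 0) at_top"
    by (rule order_tendstoD)
  then obtain s1 where s1: "\<And>s. s \<ge> s1 \<Longrightarrow> integral\<^sup>L \<mu> (F s) < 0"
    by (auto simp: eventually_at_top_linorder)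
  show ?thesis
  proof (intro exI[of _ "max s1 1"] conjI allI impI)
    fix s assume s: "max s1 1 \<le> s"
    have F_int: "integrable \<mu> (F s)"
    proof (rule Bochner_Integration.integrable_bound)
      show "integrable \<mu> (\<lambda>x. B * \<bar>x - c\<bar>)"
        using int_c by simp
      show "AE x in \<mu>. norm (F s x) \<le> norm (B * \<bar>x - c\<bar>)"
        using bound[of s] s by (intro AE_I2) (auto intro: order_trans[OF _ abs_ge_self])
    qed simp
    have eq: "ennreal ((s - c + x) powr (- b)) * indicator {c - s / 2..} x
        = ennreal (s powr (- b) * (F s x / s + indicator {c - s / 2..} x))" for x
    proof (cases "x \<ge> c - s / 2")
      case True
      have "s - c + x = s * (1 + (x - c) / s)"
        using s by (simp add: field_simps)
      then have "(s - c + x) powr (- b) = s powr (- b) * (1 + (x - c) / s) powr (- b)"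
        using s True by (simp add: powr_mult)
      then show ?thesis
        using True s by (simp add: F_def)
    qed (simp add: F_def)
    have ind_int: "integrable \<mu> (indicator {c - s / 2..} :: real \<Rightarrow> real)"
      by (rule integrable_real_indicator) (auto simp: emeasure_eq_measure)
    have int': "integrable \<mu> (\<lambda>x. F s x / s + indicator {c - s / 2..} x)"
      using F_int ind_int by (intro Bochner_Integration.integrable_add integrable_divide)
    have nonneg: "0 \<le> s powr (- b) * (F s x / s + indicator {c - s / 2..} x)" for x
      using s by (auto simp: F_def indicator_def)
    have "(\<integral>\<^sup>+x. ennreal ((s - c + x) powr (- b)) * indicator {c - s / 2..} x \<partial>\<mu>)
        = (\<integral>\<^sup>+x. ennreal (s powr (- b) * (F s x / s + indicator {c - s / 2..} x)) \<partial>\<mu>)"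
      by (simp only: eq)
    also have "\<dots> = ennreal (\<integral>x. s powr (- b) * (F s x / s + indicator {c - s / 2..} x) \<partial>\<mu>)"
      using int' nonneg by (intro nn_integral_eq_integral) auto
    also have "\<dots> \<le> ennreal (s powr (- b))"
    proof (rule ennreal_leI)
      have "(\<integral>x. s powr (- b) * (F s x / s + indicator {c - s / 2..} x) \<partial>\<mu>)
          = s powr (- b) * (integral\<^sup>L \<mu> (F s) / s + measure \<mu> {c - s / 2..})"
        using F_int ind_int by simp
      also have "\<dots> \<le> s powr (- b) * (0 + 1)"
        using s1[of s] s by (intro mult_left_mono add_mono) (auto simp: divide_le_0_iff)
      finally show "(\<integral>x. s powr (- b) * (F s x / s + indicator {c - s / 2..} x) \<partial>\<mu>) \<le> s powr (- b)"
        by simp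
    qed
    finally show "(\<integral>\<^sup>+x. ennreal ((s - c + x) powr (- b)) * indicator {c - s / 2..} x \<partial>\<mu>) \<le> ennreal (s powr (- b))" .
  qed simp
qed

section \<open>The principle of one big jump\<close>

lemma nn_integral_exp_atLeast:
  "(\<integral>\<^sup>+u. ennreal (exp (- u)) * indicator {t..} u \<partial>lborel) = ennreal (exp (- t))"
proof -
  have "((\<lambda>u::real. - exp (- u)) \<longlongrightarrow> - 0) at_top"
    by (intro tendsto_minus filterlim_compose[OF exp_at_bot] filterlim_uminus_at_bot_at_top)
  then have "(\<integral>\<^sup>+u. ennreal (exp (- u)) * indicator {t..} u \<partial>lborel) = 0 - (- exp (- t))"
    by (intro nn_integral_FTC_atLeast) (auto intro!: derivative_eq_intros)
  then show ?thesis
    by simp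
qed

lemma nn_integral_powr_atLeast:
  assumes "p > 1" "r > 0"
  shows "(\<integral>\<^sup>+u. ennreal (u powr (- p)) * indicator {r..} u \<partial>lborel) = ennreal (r powr (1 - p) / (p - 1))"
proof -
  have "((\<lambda>u::real. - (u powr (1 - p) / (p - 1))) \<longlongrightarrow> - (0 / (p - 1))) at_top"
    using assms by (intro tendsto_intros tendsto_neg_powr filterlim_ident) auto
  moreover have "((\<lambda>u. - (u powr (1 - p) / (p - 1))) has_real_derivative u powr (- p)) (at u)" if "r \<le> u" for u
  proof -
    have "((\<lambda>u. - (u powr (1 - p) / (p - 1))) has_real_derivative - ((1 - p) * u powr (1 - p - 1) / (p - 1))) (at u)"
      using assms that
      by (intro DERIV_minus DERIV_cdivide has_real_derivative_powr) auto
    moreover have "(1 - p) / (p - 1) = - 1"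
      using assms by (simp add: field_simps)
    ultimately show ?thesis
      by (simp flip: times_divide_eq_left)
  qed
  ultimately have "(\<integral>\<^sup>+u. ennreal (u powr (- p)) * indicator {r..} u \<partial>lborel) = 0 - (- (r powr (1 - p) / (p - 1)))"
    by (intro nn_integral_FTC_atLeast) auto
  then show ?thesis
    by simp
qed

text \<open>
  The bound \<open>exp (- u)\<close> is used above the midpoint \<open>t = (d - 1) / 2\<close> and the power bound below it.
  Replacing \<open>q\<close> by \<open>q powr \<theta>\<close>, which is larger as \<open>q \<le> 1\<close>, makes the result grow only like
  \<open>A powr \<theta>\<close>, sublinearly in \<open>A\<close>.
\<close>

lemma nn_integral_two_sided_bound:
  fixes q :: "real \<Rightarrow> real"
  assumes [measurable]: "q \<in> borel_measurable borel"
    and q0: "\<And>u. 0 \<le> q u" and q1: "\<And>u. q u \<le> 1" and q_exp: "\<And>u. q u \<le> exp (- u)"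
    and q_pow: "\<And>u. d - u \<ge> 1 / 2 \<Longrightarrow> q u \<le> A * (d - u) powr (- b)"
    and d: "d \<ge> 0" and A: "A \<ge> 0" and \<theta>: "0 < \<theta>" "\<theta> < 1" "\<theta> * b > 1"
  shows "(\<integral>\<^sup>+u. ennreal (q u) \<partial>lborel)
    \<le> ennreal (exp (1 / 2 - d / 2) + A powr \<theta> * (((d + 1) / 2) powr (1 - \<theta> * b) / (\<theta> * b - 1)))"
proof -
  define p where "p = \<theta> * b"
  define t where "t = (d - 1) / 2"
  define r where "r = (d + 1) / 2"
  have p: "p > 1" and r: "r > 0" "r \<ge> 1 / 2"
    using \<theta> d by (auto simp: p_def r_def)
  have q_low: "q u \<le> A powr \<theta> * (d - u) powr (- p)" if "d - u \<ge> r" for u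
  proof -
    have "q u = q u powr 1"
      using q0 by simp
    also have "\<dots> \<le> q u powr \<theta>"
      using q0[of u] q1[of u] \<theta> by (intro powr_mono') auto
    also have "\<dots> \<le> (A * (d - u) powr (- b)) powr \<theta>"
      using q0[of u] q_pow[of u] that r \<theta> by (intro powr_mono2) auto
    also have "\<dots> = A powr \<theta> * (d - u) powr (- p)"
      using A by (simp add: powr_mult powr_powr p_def mult.commute)
    finally show ?thesis .
  qed
  have "(\<integral>\<^sup>+u. ennreal (q u) \<partial>lborel)
      \<le> (\<integral>\<^sup>+u. ennreal (exp (- u)) * indicator {t..} u
          + ennreal (A powr \<theta>) * (ennreal ((d - u) powr (- p)) * indicator {r..} (d - u)) \<partial>lborel)"
  proof (rule nn_integral_mono)
    fix u
    show "ennreal (q u) \<le> ennreal (exp (- u)) * indicator {t..} u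
          + ennreal (A powr \<theta>) * (ennreal ((d - u) powr (- p)) * indicator {r..} (d - u))"
    proof (cases "u \<ge> t")
      case True
      then show ?thesis
        using q_exp[of u] by (auto intro: order_trans[OF ennreal_leI] add_increasing2)
    next
      case False
      then have "d - u \<ge> r"
        by (auto simp: t_def r_def field_simps)
      with q_low[OF this] False show ?thesis
        by (simp add: ennreal_leI flip: ennreal_mult)
    qed
  qed
  also have "\<dots> = (\<integral>\<^sup>+u. ennreal (exp (- u)) * indicator {t..} u \<partial>lborel)
      + ennreal (A powr \<theta>) * (\<integral>\<^sup>+u. ennreal ((d - u) powr (- p)) * indicator {r..} (d - u) \<partial>lborel)"
    by (simp add: nn_integral_add nn_integral_cmult)
  also have "(\<integral>\<^sup>+u. ennreal ((d - u) powr (- p)) * indicator {r..} (d - u) \<partial>lborel)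
      = (\<integral>\<^sup>+u. ennreal (u powr (- p)) * indicator {r..} u \<partial>lborel)"
    by (subst (2) nn_integral_real_affine[where c = "- 1" and t = d]) simp_all
  also have "\<dots> = ennreal (r powr (1 - p) / (p - 1))"
    by (rule nn_integral_powr_atLeast[OF p r(1)])
  also have "(\<integral>\<^sup>+u. ennreal (exp (- u)) * indicator {t..} u \<partial>lborel) = ennreal (exp (- t))"
    by (rule nn_integral_exp_atLeast)
  also have "ennreal (exp (- t)) + ennreal (A powr \<theta>) * ennreal (r powr (1 - p) / (p - 1))
      = ennreal (exp (- t) + A powr \<theta> * (r powr (1 - p) / (p - 1)))"
    using p by (subst ennreal_plus) (auto simp flip: ennreal_mult)
  also have "exp (- t) = exp (1 / 2 - d / 2)"
    by (simp add: t_def field_simps)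
  finally show ?thesis
    by (simp add: p_def r_def)
qed

text \<open>
  Write \<open>s = c k - v\<close>. The steps \<open>X \<ge> c - s / 2\<close> contribute at most \<open>K k * G s\<close>, by \<open>G_super\<close>. The
  steps below \<open>c - s / 2\<close> have, by \<open>jump\<close>, a density of order \<open>G s\<close>, so they contribute at most a
  multiple of \<open>G s\<close> times the mass \<open>\<integral> q k (u) du\<close> of the places to land on. Hence
  \<open>q k v \<le> K k * G (c k - v)\<close> with constants that grow from \<open>k\<close> to \<open>Suc k\<close> by a multiple of that
  mass. Apart from a geometric sequence, the masses are at most of order
  \<open>A powr \<theta> * (c k + 1) powr (1 - \<theta> b)\<close> with \<open>\<theta> b > 2\<close> and \<open>A\<close> of the order of \<open>K 0\<close>. As \<open>\<theta> < 1\<close>,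
  their sum over \<open>k\<close> grows slower than \<open>K 0\<close>, and for \<open>K 0\<close> large all constants stay below \<open>2 * K 0\<close>.
\<close>

lemma one_big_jump_bound:
  fixes q :: "nat \<Rightarrow> real \<Rightarrow> real" and G :: "real \<Rightarrow> real" and \<mu> :: "real measure"
  assumes \<mu>: "sets \<mu> = sets borel"
    and q_meas[measurable]: "\<And>k. q k \<in> borel_measurable borel"
    and q0: "\<And>k v. 0 \<le> q k v" and q1: "\<And>k v. q k v \<le> 1" and q_exp: "\<And>k v. q k v \<le> exp (- v)"
    and q_start: "\<And>v. v < 0 \<Longrightarrow> q 0 v = 0"
    and q_step: "\<And>k v. ennreal (q (Suc k) v) \<le> (\<integral>\<^sup>+x. ennreal (q k (v - x)) \<partial>\<mu>)"
    and c: "c > 0"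
    and G_pos: "\<And>s. s > 0 \<Longrightarrow> G s > 0"
    and G_anti: "\<And>s t. 0 < s \<Longrightarrow> s \<le> t \<Longrightarrow> G t \<le> G s"
    and G_scale: "\<And>s. s > 0 \<Longrightarrow> G (s / 4) \<le> Cs * G s" and Cs: "Cs > 0"
    and G_power: "\<And>s. s \<ge> 1 / 2 \<Longrightarrow> G s \<le> Cp * s powr (- b)" and Cp: "Cp > 0" and b: "b > 2"
    and G_super: "\<And>s. s \<ge> s0 \<Longrightarrow>
      (\<integral>\<^sup>+x. ennreal (G (s - c + x)) * indicator {c - s / 2..} x \<partial>\<mu>) \<le> ennreal (G s)"
    and jump: "\<And>y f. y \<ge> y0 \<Longrightarrow> f \<in> borel_measurable borel \<Longrightarrow>
      (\<integral>\<^sup>+x. f x * indicator {..<- y} x \<partial>\<mu>) \<le> ennreal (Cj * G y) * (\<integral>\<^sup>+x. f x \<partial>lborel)" and Cj: "Cj > 0"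
  shows "\<exists>K>0. \<forall>k v. v < c * real k \<longrightarrow> q k v \<le> K * G (c * real k - v)"
proof -
  note [measurable_cong] = \<mu>
  \<comment> \<open>\<theta> b > 2 makes the masses summable, \<theta> < 1 makes their sum sublinear in the constant K0.\<close>
  define \<theta> where "\<theta> = (b + 2) / (2 * b)"
  have \<theta>: "0 < \<theta>" "\<theta> < 1" "\<theta> * b > 2"
    using b by (auto simp: \<theta>_def field_simps)
  define d1 where "d1 k = exp (1 / 2 - c * real k / 2)" for k
  define d2 where "d2 k = ((c * real k + 1) / 2) powr (1 - \<theta> * b) / (\<theta> * b - 1)" for k
  have d_nonneg: "d1 k \<ge> 0" "d2 k \<ge> 0" for k
    using \<theta> by (auto simp: d1_def d2_def)
  have "d1 k = exp (1 / 2) * exp (- c / 2) ^ k" for k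
  proof -
    have "1 / 2 - c * real k / 2 = 1 / 2 + real k * (- c / 2)"
      by simp
    then show ?thesis
      by (simp only: d1_def exp_add exp_of_nat_mult)
  qed
  moreover have "summable (\<lambda>k. exp (1 / 2) * exp (- c / 2) ^ k)"
    using c by (intro summable_mult summable_geometric) auto
  ultimately have d1_summable: "summable d1"
    by presburger
  have d2_summable: "summable d2"
  proof (rule summable_comparison_test_ev)
    show "eventually (\<lambda>k. norm (d2 k) \<le> (c / 2) powr (1 - \<theta> * b) / (\<theta> * b - 1) * real k powr (1 - \<theta> * b)) sequentially"
      using eventually_gt_at_top[of 0]
    proof eventually_elim
      case (elim k)
      have "((c * real k + 1) / 2) powr (1 - \<theta> * b) \<le> (c / 2 * real k) powr (1 - \<theta> * b)"
        using elim c \<theta> by (intro powr_mono2') auto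
      also have "\<dots> = (c / 2) powr (1 - \<theta> * b) * real k powr (1 - \<theta> * b)"
        using c by (intro powr_mult)
      finally show ?case
        using \<theta> d_nonneg[of k] by (simp add: d2_def divide_right_mono)
    qed
    show "summable (\<lambda>k. (c / 2) powr (1 - \<theta> * b) / (\<theta> * b - 1) * real k powr (1 - \<theta> * b))"
      using \<theta> by (intro summable_mult) (simp add: summable_real_powr_iff)
  qed
  define E where "E = Cj * Cs"
  have E: "E > 0"
    using Cj Cs by (simp add: E_def)
  \<comment> \<open>Beyond S the supermartingale inequality and the jump bound apply to s and s / 2 - c >= s / 4.\<close>
  define S where "S = Max {1, s0, 4 * c, 4 * y0}"
  have S: "S \<ge> 1" "S \<ge> s0" "S \<ge> 4 * c" "S \<ge> 4 * y0"
    by (auto simp: S_def)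
  have "((\<lambda>K. E * suminf d1 * inverse K + E * ((2 * Cp) powr \<theta> * K powr (\<theta> - 1) * suminf d2)) \<longlongrightarrow>
      E * suminf d1 * 0 + E * ((2 * Cp) powr \<theta> * 0 * suminf d2)) at_top"
    using \<theta> by (intro tendsto_intros tendsto_neg_powr tendsto_inverse_0_at_top filterlim_ident) auto
  then have "((\<lambda>K. E * suminf d1 * inverse K + E * ((2 * Cp) powr \<theta> * K powr (\<theta> - 1) * suminf d2)) \<longlongrightarrow> 0) at_top"
    by simp
  from order_tendstoD(2)[OF this, of 1]
  have "eventually (\<lambda>K. E * suminf d1 * inverse K + E * ((2 * Cp) powr \<theta> * K powr (\<theta> - 1) * suminf d2) < 1) at_top"
    by simp
  then obtain K1 where K1: "\<And>K. K \<ge> K1 \<Longrightarrow>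
      E * suminf d1 * inverse K + E * ((2 * Cp) powr \<theta> * K powr (\<theta> - 1) * suminf d2) < 1"
    by (auto simp: eventually_at_top_linorder)
  \<comment> \<open>K0 >= 1 / G S settles all s <= S, where q <= 1 is enough.\<close>
  define K0 where "K0 = Max {1, K1, 1 / G S}"
  have K0: "K0 \<ge> 1" "K0 \<ge> K1" "K0 \<ge> 1 / G S"
    by (auto simp: K0_def)
  define A where "A = 2 * K0 * Cp"
  have A: "A > 0"
    using K0 Cp by (simp add: A_def)
  have total: "E * (suminf d1 + A powr \<theta> * suminf d2) \<le> K0"
  proof -
    have "A powr \<theta> = (2 * Cp) powr \<theta> * K0 powr \<theta>"
      using K0 Cp by (simp add: A_def powr_mult mult_ac)
    also have "K0 powr \<theta> = K0 powr (\<theta> - 1) * K0"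
      using K0 by (simp add: powr_diff)
    finally have "E * (suminf d1 + A powr \<theta> * suminf d2)
        = (E * suminf d1 * inverse K0 + E * ((2 * Cp) powr \<theta> * K0 powr (\<theta> - 1) * suminf d2)) * K0"
      using K0 by (simp add: field_simps)
    also have "\<dots> \<le> 1 * K0"
      using K1[OF K0(2)] K0 by (intro mult_right_mono) auto
    finally show ?thesis
      by simp
  qed
  define D where "D k = d1 k + A powr \<theta> * d2 k" for k
  have D_nonneg: "D k \<ge> 0" for k
    using d_nonneg[of k] by (simp add: D_def)
  define K where "K k = K0 + E * (\<Sum>i<k. D i)" for k
  have K_ge: "K k \<ge> K0" for k
    using D_nonneg E by (simp add: K_def sum_nonneg)
  have K_le: "K k \<le> 2 * K0" for k
  proof -
    have "(\<Sum>i<k. D i) \<le> suminf D"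
      using D_nonneg d1_summable d2_summable unfolding D_def
      by (intro sum_le_suminf summable_add summable_mult) auto
    also have "suminf D = suminf d1 + A powr \<theta> * suminf d2"
      unfolding D_def using d1_summable d2_summable
      by (simp add: suminf_add[symmetric] suminf_mult)
    finally have "E * (\<Sum>i<k. D i) \<le> K0"
      using E total by (meson less_imp_le mult_left_mono order_trans)
    then show ?thesis
      by (simp add: K_def)
  qed
  have main: "v < c * real k \<Longrightarrow> q k v \<le> K k * G (c * real k - v)" for k v
  proof (induction k arbitrary: v)
    case 0
    then show ?case
      using q_start[of v] G_pos[of "- v"] K_ge[of 0] K0 by simp
  next
    case (Suc k)
    define s where "s = c * real (Suc k) - v"
    have s_pos: "s > 0"
      using Suc.prems by (simp add: s_def)
    have "q (Suc k) v \<le> K (Suc k) * G s"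
    proof (cases "s \<le> S")
      case True
      have "1 \<le> K0 * G S"
        using K0(3) G_pos[of S] S by (simp add: field_simps)
      also have "\<dots> \<le> K (Suc k) * G s"
        using K_ge[of "Suc k"] K0 G_anti[OF s_pos True] G_pos[of S] S by (intro mult_mono) auto
      finally show ?thesis
        using q1[of "Suc k" v] by linarith
    next
      case False
      then have sS: "s \<ge> S"
        by simp
      \<comment> \<open>Steps below c - s / 2 are the jumps larger than y.\<close>
      define y where "y = s / 2 - c"
      have y: "y \<ge> y0" "y \<ge> s / 4"
        using sS S by (auto simp: y_def)
      have integral_q: "(\<integral>\<^sup>+x. ennreal (q k (v - x)) \<partial>lborel) \<le> ennreal (D k)"
      proof -
        have "(\<integral>\<^sup>+x. ennreal (q k (v - x)) \<partial>lborel) = (\<integral>\<^sup>+u. ennreal (q k u) \<partial>lborel)"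
          by (subst (2) nn_integral_real_affine[where c = "- 1" and t = v]) simp_all
        also have "\<dots> \<le> ennreal (D k)"
          unfolding D_def d1_def d2_def
        proof (rule nn_integral_two_sided_bound)
          fix u assume u: "c * real k - u \<ge> 1 / 2"
          then have "q k u \<le> K k * G (c * real k - u)"
            by (intro Suc.IH) auto
          also have "\<dots> \<le> (2 * K0) * (Cp * (c * real k - u) powr (- b))"
            using K_le[of k] K0 G_power[OF u] G_pos[of "c * real k - u"] u
            by (intro mult_mono) auto
          finally show "q k u \<le> A * (c * real k - u) powr (- b)"
            by (simp add: A_def mult_ac)
        qed (use q0 q1 q_exp c A \<theta> in auto)
        finally show ?thesis .
      qed
      have "G y \<le> Cs * G s"
        using G_anti[of "s / 4" y] G_scale[of s] y s_pos by auto
      then have G_y: "Cj * G y \<le> E * G s"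
        using Cj by (simp add: E_def mult.assoc)
      have "ennreal (q (Suc k) v) \<le> (\<integral>\<^sup>+x. ennreal (q k (v - x)) \<partial>\<mu>)"
        by (rule q_step)
      also have "\<dots> = (\<integral>\<^sup>+x. ennreal (q k (v - x)) * indicator {c - s / 2..} x
          + ennreal (q k (v - x)) * indicator {..<- y} x \<partial>\<mu>)"
        by (intro nn_integral_cong) (auto simp: indicator_def y_def)
      also have "\<dots> = (\<integral>\<^sup>+x. ennreal (q k (v - x)) * indicator {c - s / 2..} x \<partial>\<mu>)
          + (\<integral>\<^sup>+x. ennreal (q k (v - x)) * indicator {..<- y} x \<partial>\<mu>)"
        by (rule nn_integral_add) measurable
      also have "\<dots> \<le> ennreal (K k * G s) + ennreal (E * D k * G s)"
      proof (rule add_mono)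
        have "(\<integral>\<^sup>+x. ennreal (q k (v - x)) * indicator {c - s / 2..} x \<partial>\<mu>)
            \<le> (\<integral>\<^sup>+x. ennreal (K k) * (ennreal (G (s - c + x)) * indicator {c - s / 2..} x) \<partial>\<mu>)"
        proof (rule nn_integral_mono)
          fix x
          show "ennreal (q k (v - x)) * indicator {c - s / 2..} x
              \<le> ennreal (K k) * (ennreal (G (s - c + x)) * indicator {c - s / 2..} x)"
          proof (cases "x \<ge> c - s / 2")
            case True
            have eq: "c * real k - (v - x) = s - c + x"
              by (simp add: s_def algebra_simps)
            moreover have "s - c + x > 0"
              using True s_pos by (simp add: field_simps)
            ultimately have "v - x < c * real k"
              by linarith
            from Suc.IH[OF this] have "q k (v - x) \<le> K k * G (s - c + x)"
              unfolding eq .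
            then show ?thesis
              using True K_ge[of k] K0 by (simp add: ennreal_leI flip: ennreal_mult')
          qed simp
        qed
        also have "\<dots> = ennreal (K k) * (\<integral>\<^sup>+x. ennreal (G (s - c + x)) * indicator {c - s / 2..} x \<partial>\<mu>)"
        proof (rule nn_integral_cmult)
          have "mono (\<lambda>z. - G (max (s / 2) z))"
            using G_anti s_pos by (intro monoI) auto
          then have "(\<lambda>z. - G (max (s / 2) z)) \<in> borel_measurable borel"
            by (rule borel_measurable_mono)
          then have [measurable]: "(\<lambda>z. G (max (s / 2) z)) \<in> borel_measurable borel"
            by simp
          have "ennreal (G (s - c + x)) * indicator {c - s / 2..} x
              = ennreal (G (max (s / 2) (s - c + x))) * indicator {c - s / 2..} x" for x
            by (auto simp: indicator_def max_def field_simps)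
          then show "(\<lambda>x. ennreal (G (s - c + x)) * indicator {c - s / 2..} x) \<in> borel_measurable \<mu>"
            by simp
        qed
        also have "\<dots> \<le> ennreal (K k) * ennreal (G s)"
          using sS S by (intro mult_left_mono G_super) auto
        finally show "(\<integral>\<^sup>+x. ennreal (q k (v - x)) * indicator {c - s / 2..} x \<partial>\<mu>) \<le> ennreal (K k * G s)"
          using K_ge[of k] K0 by (simp add: ennreal_mult')
      next
        have "(\<integral>\<^sup>+x. ennreal (q k (v - x)) * indicator {..<- y} x \<partial>\<mu>)
            \<le> ennreal (Cj * G y) * (\<integral>\<^sup>+x. ennreal (q k (v - x)) \<partial>lborel)"
          by (rule jump[OF y(1)]) measurable
        also have "\<dots> \<le> ennreal (E * G s) * ennreal (D k)"
          by (intro mult_mono integral_q ennreal_leI[OF G_y]) auto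
        also have "\<dots> = ennreal (E * D k * G s)"
          using E D_nonneg G_pos[OF s_pos] by (simp add: mult_ac flip: ennreal_mult)
        finally show "(\<integral>\<^sup>+x. ennreal (q k (v - x)) * indicator {..<- y} x \<partial>\<mu>) \<le> ennreal (E * D k * G s)" .
      qed
      also have "\<dots> = ennreal (K (Suc k) * G s)"
        using K_ge[of k] K0 E D_nonneg[of k] G_pos[OF s_pos]
        by (simp add: K_def distrib_left distrib_right flip: ennreal_plus)
      finally show ?thesis
        using K_ge[of "Suc k"] K0 G_pos[OF s_pos] by (simp add: ennreal_le_iff)
    qed
    then show ?case
      by (simp add: s_def)
  qed
  show ?thesis
  proof (intro exI[of _ "2 * K0"] conjI allI impI)
    fix k v assume v: "v < c * real k"
    have "q k v \<le> K k * G (c * real k - v)"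
      by (rule main[OF v])
    also have "\<dots> \<le> 2 * K0 * G (c * real k - v)"
      using K_le[of k] G_pos[of "c * real k - v"] v by (intro mult_right_mono) auto
    finally show "q k v \<le> 2 * K0 * G (c * real k - v)" .
  qed (use K0 in simp)
qed

section \<open>The branching recursion and the change of measure\<close>

text \<open>
  \<open>reaches k v \<rho>\<close>: in the environment \<open>\<rho>\<close>, which gives each label its reproduction, some particle of
  generation \<open>k\<close> lies at or below \<open>v\<close>. The recursion splits off the first generation, so that the
  branching property holds by definition and measurability follows by induction, as only countable
  unions occur.
\<close>

primrec reaches :: "nat \<Rightarrow> real \<Rightarrow> (nat list \<Rightarrow> enat \<times> (nat \<Rightarrow> real)) \<Rightarrow> bool" where
  "reaches 0 v \<rho> \<longleftrightarrow> 0 \<le> v"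
| "reaches (Suc k) v \<rho> \<longleftrightarrow>
     (\<exists>j. enat j < fst (\<rho> []) \<and> reaches k (v - snd (\<rho> []) j) (\<lambda>w. \<rho> (j # w)))"

abbreviation environment_space :: "(nat list \<Rightarrow> enat \<times> (nat \<Rightarrow> real)) measure" where
  "environment_space \<equiv> \<Pi>\<^sub>M u\<in>UNIV. reproduction_space"

lemma space_reproduction_space [simp]: "space reproduction_space = UNIV"
  by (simp add: reproduction_space_def space_pair_measure space_PiM)

lemma measurable_fst_reproduction:
  "fst \<in> reproduction_space \<rightarrow>\<^sub>M count_space UNIV"
  unfolding reproduction_space_def by measurable

lemma measurable_snd_reproduction:
  "(\<lambda>r. snd r j) \<in> borel_measurable reproduction_space"
  unfolding reproduction_space_def by measurable

lemma measurable_root: "(\<lambda>\<rho>. \<rho> []) \<in> environment_space \<rightarrow>\<^sub>M reproduction_space"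
  by (rule measurable_component_singleton) simp

lemma measurable_subtree:
  "(\<lambda>\<rho> w. \<rho> (j # w)) \<in> environment_space \<rightarrow>\<^sub>M environment_space"
  by (rule measurable_PiM_single') (auto simp: space_PiM)

lemma measurable_reaches:
  "Measurable.pred (borel \<Otimes>\<^sub>M environment_space) (\<lambda>(v, \<rho>). reaches k v \<rho>)"
proof (induction k)
  case (Suc k)
  let ?S = "borel \<Otimes>\<^sub>M environment_space"
  note root = measurable_compose[OF measurable_snd measurable_root]
  have shift: "(\<lambda>x. (fst x - snd (snd x []) j, \<lambda>w. snd x (j # w))) \<in> ?S \<rightarrow>\<^sub>M ?S" for j
    by (intro measurable_Pair borel_measurable_diff measurable_fst
        measurable_compose[OF root measurable_snd_reproduction]
        measurable_compose[OF measurable_snd measurable_subtree])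
  have "Measurable.pred ?S (\<lambda>x. enat j < fst (snd x []))" for j
    by (rule measurable_compose[OF root measurable_compose[OF measurable_fst_reproduction]]) simp
  moreover have "Measurable.pred ?S (\<lambda>x. reaches k (fst x - snd (snd x []) j) (\<lambda>w. snd x (j # w)))" for j
    using measurable_compose[OF shift Suc.IH] by simp
  ultimately show ?case
    unfolding case_prod_beta reaches.simps by (intro pred_intros_countable pred_intros_logic)
qed simp

lemma reaches_mono: "reaches k v \<rho> \<Longrightarrow> v \<le> v' \<Longrightarrow> reaches k v' \<rho>"
proof (induction k arbitrary: v v' \<rho>)
  case (Suc k)
  then show ?case
    by (force intro: diff_right_mono)
qed simp

lemma reachesI:
  assumes "u \<in> gw_tree N \<omega>" "position D u \<omega> \<le> v"
  shows "reaches (length u) v (\<lambda>w. reproduction N D w \<omega>)"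
  using assms
proof (induction u arbitrary: N D v)
  case Nil
  then show ?case
    by (simp add: position_def)
next
  case (Cons j u)
  have root: "enat j < N [] \<omega>"
    using Cons.prems(1) by (force simp: gw_tree_def)
  have sub: "u \<in> gw_tree (\<lambda>w. N (j # w)) \<omega>"
    using Cons.prems(1) by (fastforce simp: gw_tree_def)
  have "position D (j # u) \<omega> = D [] j \<omega> + position (\<lambda>w. D (j # w)) u \<omega>"
    by (simp add: position_def sum.lessThan_Suc_shift del: sum.lessThan_Suc)
  then have "position (\<lambda>w. D (j # w)) u \<omega> \<le> v - D [] j \<omega>"
    using Cons.prems(2) by simp
  from Cons.IH[OF sub this] root show ?case
    by (auto simp: reproduction_def intro!: exI[of _ j])
qed

lemma generation_1: "generation N 1 \<omega> = (\<lambda>j. [j]) ` {j. enat j < N [] \<omega>}"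
  by (auto simp: generation_def gw_tree_def length_Suc_conv)

lemma position_singleton: "position D [j] \<omega> = D [] j \<omega>"
  by (simp add: position_def)

lemma infsum_generation_1:
  fixes g :: "real \<Rightarrow> 'b :: {topological_comm_monoid_add, t2_space, semiring_1}"
  shows "(\<Sum>\<^sub>\<infinity>u\<in>generation N 1 \<omega>. g (position D u \<omega>)) =
    (\<Sum>\<^sub>\<infinity>j. indicator {j. enat j < N [] \<omega>} j * g (D [] j \<omega>))"
proof -
  have "inj_on (\<lambda>j. [j]) {j. enat j < N [] \<omega>}"
    by (simp add: inj_on_def)
  from infsum_reindex[OF this, of "\<lambda>u. g (position D u \<omega>)"]
  have "(\<Sum>\<^sub>\<infinity>u\<in>generation N 1 \<omega>. g (position D u \<omega>)) = (\<Sum>\<^sub>\<infinity>j\<in>{j. enat j < N [] \<omega>}. g (D [] j \<omega>))"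
    by (simp only: generation_1 o_def position_singleton)
  also have "\<dots> = (\<Sum>\<^sub>\<infinity>j. indicator {j. enat j < N [] \<omega>} j * g (D [] j \<omega>))"
    by (rule infsum_cong_neutral) auto
  finally show ?thesis .
qed

lemma infsum_ennreal_eq_suminf: "(\<Sum>\<^sub>\<infinity>j. f j) = (\<Sum>j. f j)" for f :: "nat \<Rightarrow> ennreal"
proof -
  have "f summable_on UNIV"
    by (rule nonneg_summable_on_complete) simp
  from has_sum_imp_sums[OF has_sum_infsum[OF this]] show ?thesis
    by (simp add: sums_iff)
qed

text \<open>
  For a divergent series both sides are \<open>0\<close>, by the conventions for \<open>infsum\<close> and \<open>enn2real\<close>.
\<close>

lemma infsum_real_eq_enn2real_suminf:
  fixes f :: "nat \<Rightarrow> real"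
  assumes f: "\<And>j. f j \<ge> 0"
  shows "(\<Sum>\<^sub>\<infinity>j. f j) = enn2real (\<Sum>j. ennreal (f j))"
proof (cases "summable f")
  case True
  then have "(\<Sum>\<^sub>\<infinity>j. f j) = suminf f"
    using sums_nonneg_imp_has_sum[of f "suminf f"] f by (auto intro: infsumI)
  then show ?thesis
    using True f by (simp add: suminf_ennreal2 suminf_nonneg)
next
  case False
  then have "\<not> f summable_on UNIV"
    using has_sum_imp_sums by (auto simp: summable_on_def summable_def)
  moreover have "(\<Sum>j. ennreal (f j)) = top"
    using False summable_suminf_not_top[where f = f, OF f] by blast
  ultimately show ?thesis
    by (simp add: infsum_not_exists)
qed

context branching_random_walk
begin

definition environment :: "'a \<Rightarrow> nat list \<Rightarrow> enat \<times> (nat \<Rightarrow> real)" where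
  "environment \<omega> = (\<lambda>w. reproduction N D w \<omega>)"

lemma measurable_reproduction [measurable]: "reproduction N D u \<in> M \<rightarrow>\<^sub>M reproduction_space"
  using indep_reproduction by (auto simp: indep_vars_def)

lemma measurable_environment [measurable]: "environment \<in> M \<rightarrow>\<^sub>M environment_space"
  unfolding environment_def by (rule measurable_PiM_single') (auto simp: space_PiM)

text \<open>
  Independent and identically distributed reproductions give the environment a product law, which is
  invariant under the injective relabelling \<open>w \<mapsto> j # w\<close>.
\<close>

lemma subtree_same_law:
  "distr M environment_space (\<lambda>\<omega> w. environment \<omega> (j # w)) = distr M environment_space environment"
proof -
  define R where "R = distr M reproduction_space (reproduction N D [])"
  have R: "distr M reproduction_space (reproduction N D u) = R" for u
    unfolding R_def by (rule same_law_reproduction)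
  interpret R: prob_space R
    unfolding R_def by (rule prob_space_distr) measurable
  have sets_R: "sets (\<Pi>\<^sub>M u\<in>UNIV. R) = sets environment_space"
    by (rule sets_PiM_cong) (auto simp: R_def)
  have "distr M environment_space (\<lambda>\<omega>. \<lambda>u\<in>UNIV. reproduction N D u \<omega>) = (\<Pi>\<^sub>M u\<in>UNIV. R)"
    using indep_vars_iff_distr_eq_PiM[where I = UNIV and M' = "\<lambda>_. reproduction_space" and X = "reproduction N D"]
      indep_reproduction by (simp add: R)
  then have law: "distr M environment_space environment = (\<Pi>\<^sub>M u\<in>UNIV. R)"
    by (simp add: environment_def[abs_def] restrict_UNIV)
  have "distr (\<Pi>\<^sub>M u\<in>UNIV. R) (\<Pi>\<^sub>M u\<in>UNIV. R) (\<lambda>\<rho>. \<lambda>w\<in>UNIV. \<rho> (j # w)) = (\<Pi>\<^sub>M u\<in>UNIV. R)"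
    by (rule distr_PiM_reindex[of UNIV "\<lambda>_. R" "(#) j" UNIV]) (auto intro: R.prob_space_axioms)
  then have "distr (\<Pi>\<^sub>M u\<in>UNIV. R) environment_space (\<lambda>\<rho> w. \<rho> (j # w)) = (\<Pi>\<^sub>M u\<in>UNIV. R)"
    by (simp add: restrict_UNIV sets_R cong: distr_cong)
  then show ?thesis
    unfolding law[symmetric]
    by (simp add: distr_distr[OF measurable_subtree measurable_environment] o_def)
qed

text \<open>
  The reproduction of the root is written as a constant environment because \<open>indep_var\<close> relates two
  random variables with values in the same type.
\<close>

lemma indep_root_subtree:
  "indep_var environment_space (\<lambda>\<omega> _. reproduction N D [] \<omega>)
    environment_space (\<lambda>\<omega> w. environment \<omega> (j # w))"
proof -
  have "indep_var (Pi\<^sub>M {[]} (\<lambda>_. reproduction_space)) (\<lambda>\<omega>. restrict (\<lambda>i. reproduction N D i \<omega>) {[]})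
     (Pi\<^sub>M (range ((#) j)) (\<lambda>_. reproduction_space)) (\<lambda>\<omega>. restrict (\<lambda>i. reproduction N D i \<omega>) (range ((#) j)))"
    by (rule indep_var_restrict[OF indep_reproduction]) auto
  then have "indep_var environment_space ((\<lambda>r _. r []) \<circ> (\<lambda>\<omega>. restrict (\<lambda>i. reproduction N D i \<omega>) {[]}))
     environment_space ((\<lambda>\<rho> w. \<rho> (j # w)) \<circ> (\<lambda>\<omega>. restrict (\<lambda>i. reproduction N D i \<omega>) (range ((#) j))))"
  proof (rule indep_var_compose)
    show "(\<lambda>\<rho> w. \<rho> (j # w)) \<in> Pi\<^sub>M (range ((#) j)) (\<lambda>_. reproduction_space) \<rightarrow>\<^sub>M environment_space"
      by (rule measurable_PiM_single') (auto simp: space_PiM)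
    show "(\<lambda>r _. r []) \<in> Pi\<^sub>M {[]} (\<lambda>_. reproduction_space) \<rightarrow>\<^sub>M environment_space"
      by (rule measurable_PiM_single') (auto simp: space_PiM)
  qed
  then show ?thesis
    by (simp add: o_def environment_def)
qed

lemma measurable_offspring_sum_term:
  fixes g :: "real \<Rightarrow> ennreal"
  assumes [measurable]: "g \<in> borel_measurable borel"
  shows "(\<lambda>\<omega>. indicator {j. enat j < N [] \<omega>} j * g (D [] j \<omega>)) \<in> borel_measurable M"
proof -
  have "indicator {j. enat j < N [] \<omega>} j * g (D [] j \<omega>)
      = (if enat j < fst (reproduction N D [] \<omega>) then g (snd (reproduction N D [] \<omega>) j) else 0)" for \<omega>
    by (simp add: reproduction_def)
  moreover have "(\<lambda>\<omega>. if enat j < fst (reproduction N D [] \<omega>) then g (snd (reproduction N D [] \<omega>) j) else 0)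
      \<in> borel_measurable M"
  proof (rule measurable_If)
    show "(\<lambda>\<omega>. g (snd (reproduction N D [] \<omega>) j)) \<in> borel_measurable M"
      by (rule measurable_compose[OF measurable_compose[OF measurable_reproduction measurable_snd_reproduction] assms])
    have "Measurable.pred M (\<lambda>\<omega>. enat j < fst (reproduction N D [] \<omega>))"
      by (rule measurable_compose[OF measurable_compose[OF measurable_reproduction measurable_fst_reproduction]]) simp
    then show "{\<omega> \<in> space M. enat j < fst (reproduction N D [] \<omega>)} \<in> sets M"
      by simp
  qed simp
  ultimately show ?thesis
    by simp
qed

definition reach_prob :: "nat \<Rightarrow> real \<Rightarrow> real" where
  "reach_prob k v = measure M {\<omega> \<in> space M. reaches k v (environment \<omega>)}"

lemma pred_reaches [measurable]: "Measurable.pred environment_space (reaches k v)"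
  using measurable_compose[OF measurable_Pair1'[of v borel] measurable_reaches[of k]]
  by simp

lemma reach_prob_mono: "v \<le> v' \<Longrightarrow> reach_prob k v \<le> reach_prob k v'"
  unfolding reach_prob_def by (rule finite_measure_mono) (auto intro: reaches_mono)

lemma measurable_reach_prob [measurable]: "reach_prob k \<in> borel_measurable borel"
  by (rule borel_measurable_mono) (auto intro: monoI reach_prob_mono)

text \<open>
  A union bound over the children of the root, each of which starts an independent copy of the process
  from its own position.
\<close>

lemma reach_prob_branching:
  "ennreal (reach_prob (Suc k) v) \<le>
    (\<integral>\<^sup>+\<omega>. (\<Sum>j. indicator {j. enat j < N [] \<omega>} j * ennreal (reach_prob k (v - D [] j \<omega>))) \<partial>M)"
proof -
  let ?ES = environment_space
  define A :: "nat \<Rightarrow> ((nat list \<Rightarrow> enat \<times> (nat \<Rightarrow> real)) \<times> (nat list \<Rightarrow> enat \<times> (nat \<Rightarrow> real))) set"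
    where "A j = {x. enat j < fst (fst x []) \<and> reaches k (v - snd (fst x []) j) (snd x)}" for j
  have A: "A j \<in> sets (?ES \<Otimes>\<^sub>M ?ES)" for j
  proof -
    note root = measurable_compose[OF measurable_fst measurable_root]
    have "(\<lambda>x. (v - snd (fst x []) j, snd x)) \<in> ?ES \<Otimes>\<^sub>M ?ES \<rightarrow>\<^sub>M borel \<Otimes>\<^sub>M ?ES"
      by (intro measurable_Pair borel_measurable_diff measurable_snd borel_measurable_const
          measurable_compose[OF root measurable_snd_reproduction])
    from measurable_compose[OF this measurable_reaches[of k]]
    have "Measurable.pred (?ES \<Otimes>\<^sub>M ?ES) (\<lambda>x. reaches k (v - snd (fst x []) j) (snd x))"
      by simp
    moreover have "Measurable.pred (?ES \<Otimes>\<^sub>M ?ES) (\<lambda>x. enat j < fst (fst x []))"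
      by (rule measurable_compose[OF root measurable_compose[OF measurable_fst_reproduction]]) simp
    ultimately have "Measurable.pred (?ES \<Otimes>\<^sub>M ?ES) (\<lambda>x. enat j < fst (fst x []) \<and> reaches k (v - snd (fst x []) j) (snd x))"
      by (intro pred_intros_logic)
    then show ?thesis
      by (simp add: A_def pred_def space_pair_measure space_PiM)
  qed
  have sub: "(\<lambda>\<omega> w. environment \<omega> (j # w)) \<in> M \<rightarrow>\<^sub>M ?ES" for j
    using measurable_compose[OF measurable_environment measurable_subtree] .
  have root: "(\<lambda>\<omega> _. reproduction N D [] \<omega>) \<in> M \<rightarrow>\<^sub>M ?ES"
    by (rule measurable_PiM_single') (auto simp: space_PiM)
  define B where "B j = {\<omega> \<in> space M. (\<lambda>_. reproduction N D [] \<omega>, \<lambda>w. environment \<omega> (j # w)) \<in> A j}" for j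
  have B: "B j \<in> sets M" for j
    using measurable_sets[OF measurable_Pair[OF root sub] A] by (simp add: B_def vimage_def Int_def conj_commute)
  have emeasure_B: "emeasure M (B j) =
    (\<integral>\<^sup>+\<omega>. indicator {j. enat j < N [] \<omega>} j * ennreal (reach_prob k (v - D [] j \<omega>)) \<partial>M)" for j
  proof -
    define T where "T = distr M ?ES environment"
    interpret T: prob_space T
      unfolding T_def by (rule prob_space_distr) measurable
    have sets_T[measurable_cong]: "sets T = sets ?ES"
      by (simp add: T_def)
    have "distr M ?ES (\<lambda>\<omega> _. reproduction N D [] \<omega>) \<Otimes>\<^sub>M T =
        distr M (?ES \<Otimes>\<^sub>M ?ES) (\<lambda>\<omega>. (\<lambda>_. reproduction N D [] \<omega>, \<lambda>w. environment \<omega> (j # w)))"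
      using indep_root_subtree[of j] unfolding indep_var_distribution_eq T_def
      by (simp add: subtree_same_law)
    moreover have "emeasure M (B j) =
        emeasure (distr M (?ES \<Otimes>\<^sub>M ?ES) (\<lambda>\<omega>. (\<lambda>_. reproduction N D [] \<omega>, \<lambda>w. environment \<omega> (j # w)))) (A j)"
      by (subst emeasure_distr[OF measurable_Pair[OF root sub] A])
        (auto simp: B_def intro!: arg_cong[where f = "emeasure M"])
    ultimately have "emeasure M (B j) = emeasure (distr M ?ES (\<lambda>\<omega> _. reproduction N D [] \<omega>) \<Otimes>\<^sub>M T) (A j)"
      by simp
    also have "\<dots> = (\<integral>\<^sup>+r. emeasure T (Pair r -` A j) \<partial>distr M ?ES (\<lambda>\<omega> _. reproduction N D [] \<omega>))"
    proof (rule T.emeasure_pair_measure_alt)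
      have "sets (distr M ?ES (\<lambda>\<omega> _. reproduction N D [] \<omega>) \<Otimes>\<^sub>M T) = sets (?ES \<Otimes>\<^sub>M ?ES)"
        by (rule sets_pair_measure_cong) (simp_all add: sets_T)
      then show "A j \<in> sets (distr M ?ES (\<lambda>\<omega> _. reproduction N D [] \<omega>) \<Otimes>\<^sub>M T)"
        using A by simp
    qed
    also have "\<dots> = (\<integral>\<^sup>+\<omega>. emeasure T (Pair (\<lambda>_. reproduction N D [] \<omega>) -` A j) \<partial>M)"
      by (rule nn_integral_distr[OF root])
        (use T.measurable_emeasure_Pair[of "A j" ?ES] A[of j] sets_pair_measure_cong[OF refl sets_T, of ?ES] in simp)
    also have "\<dots> = (\<integral>\<^sup>+\<omega>. indicator {j. enat j < N [] \<omega>} j * ennreal (reach_prob k (v - D [] j \<omega>)) \<partial>M)"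
    proof (rule nn_integral_cong)
      fix \<omega>
      show "emeasure T (Pair (\<lambda>_. reproduction N D [] \<omega>) -` A j)
          = indicator {j. enat j < N [] \<omega>} j * ennreal (reach_prob k (v - D [] j \<omega>))"
      proof (cases "enat j < N [] \<omega>")
        case True
        then have "Pair (\<lambda>_. reproduction N D [] \<omega>) -` A j = {\<rho> \<in> space ?ES. reaches k (v - D [] j \<omega>) \<rho>}"
          by (auto simp: A_def reproduction_def space_PiM)
        then have "emeasure T (Pair (\<lambda>_. reproduction N D [] \<omega>) -` A j)
            = emeasure M (environment -` {\<rho> \<in> space ?ES. reaches k (v - D [] j \<omega>) \<rho>} \<inter> space M)"
          by (simp add: T_def emeasure_distr)
        also have "environment -` {\<rho> \<in> space ?ES. reaches k (v - D [] j \<omega>) \<rho>} \<inter> space M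
            = {\<omega>' \<in> space M. reaches k (v - D [] j \<omega>) (environment \<omega>')}"
          by (auto simp: space_PiM)
        finally show ?thesis
          using True by (simp add: reach_prob_def emeasure_eq_measure)
      next
        case False
        then have "Pair (\<lambda>_. reproduction N D [] \<omega>) -` A j = {}"
          by (auto simp: A_def reproduction_def)
        then show ?thesis
          using False by simp
      qed
    qed
    finally show ?thesis .
  qed
  have "ennreal (reach_prob (Suc k) v) = emeasure M (\<Union>j. B j)"
    unfolding reach_prob_def emeasure_eq_measure[symmetric]
    by (intro arg_cong[where f = "emeasure M"]) (auto simp: B_def A_def environment_def)
  also have "\<dots> \<le> (\<Sum>j. emeasure M (B j))"
    using B by (intro emeasure_subadditive_countably) auto
  also have "\<dots> = (\<integral>\<^sup>+\<omega>. (\<Sum>j. indicator {j. enat j < N [] \<omega>} j * ennreal (reach_prob k (v - D [] j \<omega>))) \<partial>M)"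
    unfolding emeasure_B
    by (rule nn_integral_suminf[symmetric], rule measurable_offspring_sum_term) measurable
  finally show ?thesis .
qed

text \<open>
  In an infinite generation the infimum need not be attained, but some particle lies below each
  larger level; hence the additional \<open>1\<close>.
\<close>

lemma min_position_le_reach_prob:
  "measure M {\<omega> \<in> space M. min_position N D n \<omega> \<le> ereal a} \<le> reach_prob n (a + 1)"
  unfolding reach_prob_def
proof (rule finite_measure_mono)
  show "{\<omega> \<in> space M. min_position N D n \<omega> \<le> ereal a} \<subseteq> {\<omega> \<in> space M. reaches n (a + 1) (environment \<omega>)}"
  proof safe
    fix \<omega> assume "min_position N D n \<omega> \<le> ereal a"
    also have "\<dots> < ereal (a + 1)"
      by simp
    finally obtain u where "u \<in> generation N n \<omega>" "position D u \<omega> < a + 1"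
      by (auto simp: min_position_def INF_less_iff)
    then show "reaches n (a + 1) (environment \<omega>)"
      using reachesI[of u N \<omega> D "a + 1"] by (simp add: generation_def environment_def)
  qed
qed measurable

text \<open>
  The change of measure that defines \<open>X\<close>, for integrals with values in the extended reals. The
  normalization bounds the weighted sum over the children in mean, which makes it finite almost surely,
  so that the real-valued sums in the law of \<open>X\<close> lose nothing.
\<close>

lemma many_to_one_le:
  fixes \<mu> :: "real measure" and g :: "real \<Rightarrow> real"
  assumes "prob_space \<mu>" and \<mu>: "sets \<mu> = sets borel"
    and normalized: "(\<integral>\<^sup>+ \<omega>. (\<Sum>\<^sub>\<infinity>u\<in>generation N 1 \<omega>. ennreal (exp (- position D u \<omega>))) \<partial>M) = 1"
    and law: "\<And>f :: real \<Rightarrow> real. f \<in> borel_measurable borel \<Longrightarrow> bounded (range f) \<Longrightarrow>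
      (\<integral>x. f x \<partial>\<mu>) =
      (\<integral>\<omega>. (\<Sum>\<^sub>\<infinity>u\<in>generation N 1 \<omega>. f (position D u \<omega>) * exp (- position D u \<omega>)) \<partial>M)"
    and g[measurable]: "g \<in> borel_measurable borel" and g0: "\<And>x. 0 \<le> g x" and g1: "\<And>x. g x \<le> 1"
  shows "(\<integral>\<^sup>+\<omega>. (\<Sum>j. indicator {j. enat j < N [] \<omega>} j * ennreal (g (D [] j \<omega>) * exp (- D [] j \<omega>))) \<partial>M)
    \<le> (\<integral>\<^sup>+x. ennreal (g x) \<partial>\<mu>)"
proof -
  interpret \<mu>: prob_space \<mu> by fact
  note [measurable_cong] = \<mu>
  define W where "W h \<omega> = (\<Sum>j. indicator {j. enat j < N [] \<omega>} j * ennreal (h (D [] j \<omega>) * exp (- D [] j \<omega>)))"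
    for h :: "real \<Rightarrow> real" and \<omega>
  have W_meas: "W h \<in> borel_measurable M" if [measurable]: "h \<in> borel_measurable borel" for h
    unfolding W_def by (intro borel_measurable_suminf_order measurable_offspring_sum_term) measurable
  note Wg[measurable] = W_meas[OF g]
  have total: "(\<integral>\<^sup>+\<omega>. W (\<lambda>_. 1) \<omega> \<partial>M) = 1"
    using normalized by (simp only: infsum_generation_1[where g = "\<lambda>x. ennreal (exp (- x))"] infsum_ennreal_eq_suminf W_def mult_1)
  have "(\<integral>\<^sup>+\<omega>. W g \<omega> \<partial>M) \<le> (\<integral>\<^sup>+\<omega>. W (\<lambda>_. 1) \<omega> \<partial>M)"
    unfolding W_def using g1
    by (intro nn_integral_mono suminf_le mult_left_mono ennreal_leI) auto
  then have W_le: "(\<integral>\<^sup>+\<omega>. W g \<omega> \<partial>M) \<le> 1"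
    by (simp add: total)
  then have "AE \<omega> in M. W g \<omega> \<noteq> \<infinity>"
    by (intro nn_integral_noteq_infinite) (auto simp: top_unique)
  then have fin: "AE \<omega> in M. ennreal (enn2real (W g \<omega>)) = W g \<omega>"
    by eventually_elim (simp add: less_top)
  have real_sum: "(\<Sum>\<^sub>\<infinity>u\<in>generation N 1 \<omega>. g (position D u \<omega>) * exp (- position D u \<omega>)) = enn2real (W g \<omega>)" for \<omega>
  proof -
    have "(\<Sum>\<^sub>\<infinity>u\<in>generation N 1 \<omega>. g (position D u \<omega>) * exp (- position D u \<omega>))
        = (\<Sum>\<^sub>\<infinity>j. indicator {j. enat j < N [] \<omega>} j * (g (D [] j \<omega>) * exp (- D [] j \<omega>)))"
      by (rule infsum_generation_1[where g = "\<lambda>x. g x * exp (- x)"])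
    also have "\<dots> = enn2real (\<Sum>j. ennreal (indicator {j. enat j < N [] \<omega>} j * (g (D [] j \<omega>) * exp (- D [] j \<omega>))))"
      by (rule infsum_real_eq_enn2real_suminf) (simp add: g0)
    also have "(\<lambda>j. ennreal (indicator {j. enat j < N [] \<omega>} j * (g (D [] j \<omega>) * exp (- D [] j \<omega>))))
        = (\<lambda>j. indicator {j. enat j < N [] \<omega>} j * ennreal (g (D [] j \<omega>) * exp (- D [] j \<omega>)))"
      by (auto simp: indicator_def)
    finally show ?thesis
      by (simp add: W_def)
  qed
  have "bounded (range g)"
    using g0 g1 by (auto intro!: boundedI[where B = 1])
  then have "(\<integral>x. g x \<partial>\<mu>) = (\<integral>\<omega>. enn2real (W g \<omega>) \<partial>M)"
    by (simp only: law[OF g] real_sum)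
  also have "\<dots> = enn2real (\<integral>\<^sup>+\<omega>. ennreal (enn2real (W g \<omega>)) \<partial>M)"
    by (rule integral_eq_nn_integral) auto
  also have "(\<integral>\<^sup>+\<omega>. ennreal (enn2real (W g \<omega>)) \<partial>M) = (\<integral>\<^sup>+\<omega>. W g \<omega> \<partial>M)"
    by (rule nn_integral_cong_AE[OF fin])
  finally have "ennreal (\<integral>x. g x \<partial>\<mu>) = (\<integral>\<^sup>+\<omega>. W g \<omega> \<partial>M)"
    using W_le by (simp add: order_le_less_trans)
  moreover have "(\<integral>\<^sup>+x. ennreal (g x) \<partial>\<mu>) = ennreal (\<integral>x. g x \<partial>\<mu>)"
    using g0 g1 by (intro nn_integral_eq_integral \<mu>.integrable_const_bound[where B = 1]) auto
  ultimately show ?thesis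
    by (simp add: W_def)
qed

text \<open>
  The factor \<open>exp (- v)\<close> absorbs the weight \<open>exp (- V)\<close> of the change of measure: the expected sum
  over the children becomes an expectation over a single step of a random walk.
\<close>

definition discounted_reach_prob :: "nat \<Rightarrow> real \<Rightarrow> real" where
  "discounted_reach_prob k v = exp (- v) * reach_prob k v"

lemma measurable_discounted_reach_prob [measurable]: "discounted_reach_prob k \<in> borel_measurable borel"
  unfolding discounted_reach_prob_def by measurable

lemma discounted_reach_prob_nonneg: "0 \<le> discounted_reach_prob k v"
  by (simp add: discounted_reach_prob_def reach_prob_def)

lemma discounted_reach_prob_le_exp: "discounted_reach_prob k v \<le> exp (- v)"
  by (simp add: discounted_reach_prob_def reach_prob_def)

lemma discounted_reach_prob_0: "v < 0 \<Longrightarrow> discounted_reach_prob 0 v = 0"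
  by (simp add: discounted_reach_prob_def reach_prob_def)

lemma discounted_reach_prob_step:
  fixes \<mu> :: "real measure"
  assumes \<mu>: "prob_space \<mu>" "sets \<mu> = sets borel"
    and normalized: "(\<integral>\<^sup>+ \<omega>. (\<Sum>\<^sub>\<infinity>u\<in>generation N 1 \<omega>. ennreal (exp (- position D u \<omega>))) \<partial>M) = 1"
    and law: "\<And>f :: real \<Rightarrow> real. f \<in> borel_measurable borel \<Longrightarrow> bounded (range f) \<Longrightarrow>
      (\<integral>x. f x \<partial>\<mu>) =
      (\<integral>\<omega>. (\<Sum>\<^sub>\<infinity>u\<in>generation N 1 \<omega>. f (position D u \<omega>) * exp (- position D u \<omega>)) \<partial>M)"
  shows "discounted_reach_prob k v \<le> 1"
    and "ennreal (discounted_reach_prob (Suc k) v) \<le> (\<integral>\<^sup>+x. ennreal (discounted_reach_prob k (v - x)) \<partial>\<mu>)"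
proof -
  interpret \<mu>: prob_space \<mu> by fact
  have step: "ennreal (discounted_reach_prob (Suc k) v) \<le> (\<integral>\<^sup>+x. ennreal (discounted_reach_prob k (v - x)) \<partial>\<mu>)"
    if le_1: "\<And>v. discounted_reach_prob k v \<le> 1" for k v
  proof -
    have meas: "(\<lambda>x. ennreal (reach_prob k (v - x))) \<in> borel_measurable borel"
      by measurable
    have "ennreal (discounted_reach_prob (Suc k) v) = ennreal (exp (- v)) * ennreal (reach_prob (Suc k) v)"
      by (simp add: discounted_reach_prob_def ennreal_mult')
    also have "\<dots> \<le> ennreal (exp (- v)) *
        (\<integral>\<^sup>+\<omega>. (\<Sum>j. indicator {j. enat j < N [] \<omega>} j * ennreal (reach_prob k (v - D [] j \<omega>))) \<partial>M)"
      by (intro mult_left_mono reach_prob_branching) simp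
    also have "\<dots> = (\<integral>\<^sup>+\<omega>. ennreal (exp (- v)) *
        (\<Sum>j. indicator {j. enat j < N [] \<omega>} j * ennreal (reach_prob k (v - D [] j \<omega>))) \<partial>M)"
      by (rule nn_integral_cmult[symmetric])
        (intro borel_measurable_suminf_order measurable_offspring_sum_term meas)
    also have "\<dots> = (\<integral>\<^sup>+\<omega>. (\<Sum>j. indicator {j. enat j < N [] \<omega>} j *
        ennreal (discounted_reach_prob k (v - D [] j \<omega>) * exp (- D [] j \<omega>))) \<partial>M)"
    proof (rule nn_integral_cong)
      fix \<omega>
      have "ennreal (exp (- v)) * (i * ennreal (reach_prob k (v - d)))
          = i * ennreal (discounted_reach_prob k (v - d) * exp (- d))" for d and i :: ennreal
      proof -
        \<comment> \<open>The weight of the child at d turns the discount at v into the discount at v - d.\<close>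
        have "exp (- v) * reach_prob k (v - d) = discounted_reach_prob k (v - d) * exp (- d)"
          by (simp add: discounted_reach_prob_def exp_diff exp_minus field_simps)
        then show ?thesis
          by (metis ennreal_mult' exp_ge_zero mult.left_commute)
      qed
      then show "ennreal (exp (- v)) * (\<Sum>j. indicator {j. enat j < N [] \<omega>} j * ennreal (reach_prob k (v - D [] j \<omega>)))
          = (\<Sum>j. indicator {j. enat j < N [] \<omega>} j *
            ennreal (discounted_reach_prob k (v - D [] j \<omega>) * exp (- D [] j \<omega>)))"
        by (simp flip: ennreal_suminf_cmult)
    qed
    also have "\<dots> \<le> (\<integral>\<^sup>+x. ennreal (discounted_reach_prob k (v - x)) \<partial>\<mu>)"
    proof (rule many_to_one_le[OF \<mu> normalized law])
      show "(\<lambda>x. discounted_reach_prob k (v - x)) \<in> borel_measurable borel"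
        by measurable
    qed (simp_all add: le_1 discounted_reach_prob_nonneg)
    finally show ?thesis .
  qed
  have le_1: "discounted_reach_prob k v \<le> 1" for k v
  proof (induction k arbitrary: v)
    case 0
    then show ?case
      using discounted_reach_prob_0[of v] discounted_reach_prob_le_exp[of 0 v]
      by (cases "v < 0") (auto intro: order_trans)
  next
    case (Suc k)
    have "ennreal (discounted_reach_prob (Suc k) v) \<le> (\<integral>\<^sup>+x. ennreal (discounted_reach_prob k (v - x)) \<partial>\<mu>)"
      by (rule step[OF Suc.IH])
    also have "\<dots> \<le> (\<integral>\<^sup>+x. 1 \<partial>\<mu>)"
      using Suc.IH by (intro nn_integral_mono) simp
    finally show ?case
      by (simp add: \<mu>.emeasure_space_1)
  qed
  show "discounted_reach_prob k v \<le> 1"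
    by (rule le_1)
  show "ennreal (discounted_reach_prob (Suc k) v) \<le> (\<integral>\<^sup>+x. ennreal (discounted_reach_prob k (v - x)) \<partial>\<mu>)"
    by (rule step[OF le_1])
qed

end

section \<open>The left tail of the minimal position\<close>

text \<open>
  Two finite measures on \<open>(-\<infinity>, x0]\<close> with the same distribution function coincide.
\<close>

lemma nn_integral_tail_density:
  fixes \<mu> :: "real measure" and g :: "real \<Rightarrow> ennreal"
  assumes "finite_measure \<mu>" and \<mu>: "sets \<mu> = sets borel"
    and g: "(\<lambda>y. g y * indicator {..x0} y) \<in> borel_measurable borel"
    and tail: "\<And>x. x \<le> x0 \<Longrightarrow> emeasure \<mu> {..x} = (\<integral>\<^sup>+y. g y * indicator {..x} y \<partial>lborel)"
    and f: "f \<in> borel_measurable borel"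
  shows "(\<integral>\<^sup>+x. f x * indicator {..x0} x \<partial>\<mu>) = (\<integral>\<^sup>+x. f x * (g x * indicator {..x0} x) \<partial>lborel)"
proof -
  interpret finite_measure \<mu> by fact
  note [measurable_cong] = \<mu>
  note [measurable] = f g
  define M1 where "M1 = density \<mu> (indicator {..x0})"
  define M2 where "M2 = density lborel (\<lambda>y. g y * indicator {..x0} y)"
  have M1: "emeasure M1 {..x} = emeasure \<mu> {..min x x0}" for x
  proof -
    have "emeasure M1 {..x} = (\<integral>\<^sup>+y. indicator {..x0} y * indicator {..x} y \<partial>\<mu>)"
      unfolding M1_def by (rule emeasure_density) measurable
    also have "\<dots> = (\<integral>\<^sup>+y. indicator {..min x x0} y \<partial>\<mu>)"
      by (intro nn_integral_cong) (auto simp: indicator_def)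
    finally show ?thesis
      by simp
  qed
  have M2: "emeasure M2 {..x} = emeasure \<mu> {..min x x0}" for x
  proof -
    have "emeasure M2 {..x} = (\<integral>\<^sup>+y. g y * indicator {..x0} y * indicator {..x} y \<partial>lborel)"
      unfolding M2_def by (rule emeasure_density) measurable
    also have "\<dots> = (\<integral>\<^sup>+y. g y * indicator {..min x x0} y \<partial>lborel)"
      by (intro nn_integral_cong) (auto simp: indicator_def)
    also have "\<dots> = emeasure \<mu> {..min x x0}"
      by (rule tail[symmetric]) simp
    finally show ?thesis .
  qed
  have "emeasure M1 UNIV = emeasure \<mu> {..x0}"
    by (simp add: M1_def emeasure_density)
  moreover have "emeasure M2 UNIV = emeasure \<mu> {..x0}"
    by (simp add: M2_def emeasure_density tail)
  ultimately have "emeasure M1 UNIV < \<infinity>" "emeasure M2 UNIV < \<infinity>"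
    by (simp_all add: emeasure_eq_measure)
  then have fin: "finite_borel_measure M1" "finite_borel_measure M2"
    by (auto simp: finite_borel_measure_def finite_borel_measure_axioms_def M1_def M2_def \<mu>
        sets_eq_imp_space_eq[OF \<mu>] intro!: finite_measureI)
  have "M1 = M2"
    by (rule cdf_unique'[OF fin]) (simp add: fun_eq_iff cdf_def measure_def M1 M2)
  then have "(\<integral>\<^sup>+x. f x \<partial>M1) = (\<integral>\<^sup>+x. f x \<partial>M2)"
    by simp
  then show ?thesis
    unfolding M1_def M2_def by (simp add: nn_integral_density mult.commute)
qed

theorem proposition1p1:
  fixes M :: "'a measure"
    and N :: "nat list \<Rightarrow> 'a \<Rightarrow> enat"
    and D :: "nat list \<Rightarrow> nat \<Rightarrow> 'a \<Rightarrow> real"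
    and Q :: "'b measure"
    and X :: "'b \<Rightarrow> real"
    and \<gamma> \<alpha> x0 :: real
    and l :: "real \<Rightarrow> real"
  assumes brw: "branching_random_walk M N D"
    and supercritical: "supercritical M N"
    and normalized:
      "(\<integral>\<^sup>+ \<omega>. (\<Sum>\<^sub>\<infinity>u\<in>generation N 1 \<omega>. ennreal (exp (- position D u \<omega>))) \<partial>M) = 1"
    and Q: "prob_space Q"
    and X: "X \<in> borel_measurable Q"
    and law_X:
      "\<And>f :: real \<Rightarrow> real. f \<in> borel_measurable borel \<Longrightarrow> bounded (range f) \<Longrightarrow>
         (\<integral>x. f x \<partial>distr Q borel X) =
         (\<integral>\<omega>. (\<Sum>\<^sub>\<infinity>u\<in>generation N 1 \<omega>. f (position D u \<omega>) * exp (- position D u \<omega>)) \<partial>M)"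
    and \<gamma>: "\<gamma> > 3"
    and \<alpha>: "\<alpha> > 1"
    and x0: "x0 < 0"
    and l_slowly_varying: "slowly_varying_at_bot x0 l"
    and l_pos: "\<And>x. x \<le> x0 \<Longrightarrow> l x > 0"
    and mean_X: "integrable Q X" "(\<integral>\<omega>. X \<omega> \<partial>Q) > 0"
    and moment_X: "integrable Q (\<lambda>\<omega>. max (X \<omega>) 0 powr \<gamma>)"
    and tail_X:
      "\<And>x. x \<le> x0 \<Longrightarrow>
         emeasure Q {\<omega> \<in> space Q. X \<omega> \<le> x} =
         (\<integral>\<^sup>+ y\<in>{..x}. ennreal (\<bar>y\<bar> powr (- \<alpha> - 1) * l y) \<partial>lborel)"
  shows "\<exists>K>0. \<forall>n\<ge>2. \<forall>x\<ge>0.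
           measure M {\<omega> \<in> space M.
             min_position N D n \<omega> \<le> ereal (alpha_seq \<alpha> (extend x0 l) n - x)}
           \<le> K * exp (- x)"
proof -
  interpret branching_random_walk M N D by (rule brw)
  interpret Q: prob_space Q by (rule Q)
  define \<mu> where "\<mu> = distr Q borel X"
  have \<mu>_prob: "prob_space \<mu>"
    unfolding \<mu>_def using X by (rule Q.prob_space_distr)
  interpret \<mu>: prob_space \<mu> by (rule \<mu>_prob)
  have \<mu>_sets[measurable_cong]: "sets \<mu> = sets borel"
    by (simp add: \<mu>_def)
  define m where "m = (\<integral>x. x \<partial>\<mu>)"
  have \<mu>_int: "integrable \<mu> (\<lambda>x. x)"
    unfolding \<mu>_def using X mean_X(1) by (subst integrable_distr_eq) auto
  have m: "m > 0"
    unfolding m_def \<mu>_def using X mean_X(2) by (subst integral_distr) auto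
  define c where "c = m / 2"
  have c: "c > 0" "c < (\<integral>x. x \<partial>\<mu>)"
    using m by (auto simp: c_def m_def)

  \<comment> \<open>With this margin the smaller exponent b1 = (\<alpha> + 3) / 2 still exceeds 2.\<close>
  define \<epsilon> where "\<epsilon> = (\<alpha> - 1) / 2"
  define b1 where "b1 = \<alpha> + 1 - \<epsilon>"
  define b2 where "b2 = \<alpha> + 1 + \<epsilon>"
  have b: "\<epsilon> > 0" "b1 > 2" "0 < b1" "b1 \<le> b2"
    using \<alpha> by (auto simp: \<epsilon>_def b1_def b2_def field_simps)
  obtain Y where Y: "Y \<ge> 1" "- x0 \<le> Y"
    and potter_l: "\<And>s y. s \<ge> Y \<Longrightarrow> y \<ge> Y \<Longrightarrow>
      l (- s) \<le> exp \<epsilon> * l (- y) * ((s / y) powr \<epsilon> + (s / y) powr (- \<epsilon>))"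
    using potter_bound[OF l_slowly_varying x0 l_pos \<open>\<epsilon> > 0\<close>] by blast
  \<comment> \<open>The density of a downward jump of size s.\<close>
  define \<Phi> where "\<Phi> s = s powr (- \<alpha> - 1) * l (- s)" for s
  have \<Phi>_pos: "\<Phi> s > 0" if "s \<ge> Y" for s
    using that Y l_pos[of "- s"] by (simp add: \<Phi>_def)
  have potter: "\<Phi> s \<le> exp \<epsilon> * \<Phi> y * ((s / y) powr (- b1) + (s / y) powr (- b2))"
    if s: "s \<ge> Y" and y: "y \<ge> Y" for s y
  proof -
    have sy: "s > 0" "y > 0"
      using s y Y by auto
    have "\<Phi> s = y powr (- \<alpha> - 1) * (s / y) powr (- \<alpha> - 1) * l (- s)"
      using sy by (simp add: \<Phi>_def flip: powr_mult)
    also have "\<dots> \<le> y powr (- \<alpha> - 1) * (s / y) powr (- \<alpha> - 1) *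
        (exp \<epsilon> * l (- y) * ((s / y) powr \<epsilon> + (s / y) powr (- \<epsilon>)))"
      by (intro mult_left_mono potter_l s y) auto
    also have "\<dots> = exp \<epsilon> * \<Phi> y * ((s / y) powr (- \<alpha> - 1) * (s / y) powr \<epsilon>
        + (s / y) powr (- \<alpha> - 1) * (s / y) powr (- \<epsilon>))"
      by (simp add: \<Phi>_def algebra_simps)
    also have "(s / y) powr (- \<alpha> - 1) * (s / y) powr \<epsilon> = (s / y) powr (- b1)"
      unfolding b1_def powr_add[symmetric] by (rule arg_cong[where f = "(powr) (s / y)"]) simp
    also have "(s / y) powr (- \<alpha> - 1) * (s / y) powr (- \<epsilon>) = (s / y) powr (- b2)"
      unfolding b2_def powr_add[symmetric] by (rule arg_cong[where f = "(powr) (s / y)"]) simp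
    finally show ?thesis .
  qed

  define G where "G = power_envelope \<Phi> Y b1 b2"
  have Y0: "Y > 0"
    using Y by simp
  note env = Y0 \<Phi>_pos b(3,4)
  have G_ge: "\<Phi> s / exp \<epsilon> \<le> G s" if "s \<ge> Y" for s
    unfolding G_def by (rule power_envelope_ge[where f = \<Phi>, OF env]) (use that potter in auto)
  have G_anti: "G t \<le> G s" if "0 < s" "s \<le> t" for s t
    unfolding G_def by (rule power_envelope_antimono[where f = \<Phi>, OF env that])
  have G_pos: "G s > 0" if "s > 0" for s
  proof -
    have "0 < \<Phi> (max s Y) / exp \<epsilon>"
      using \<Phi>_pos[of "max s Y"] by simp
    also have "\<dots> \<le> G (max s Y)"
      by (rule G_ge) simp
    also have "\<dots> \<le> G s"
      using that by (intro G_anti) auto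
    finally show ?thesis .
  qed
  have G_scale: "G (\<kappa> * s) \<le> \<kappa> powr (- b2) * G s" if "0 < \<kappa>" "\<kappa> \<le> 1" "s > 0" for \<kappa> s
    unfolding G_def by (rule power_envelope_scale[where f = \<Phi>, OF env that])
  obtain Cp where Cp: "Cp > 0" "\<And>s. s \<ge> 1 / 2 \<Longrightarrow> G s \<le> Cp * s powr (- b1)"
    using power_envelope_power_bound[where f = \<Phi>, OF env] unfolding G_def by blast
  obtain s1 where s1: "\<And>s. s \<ge> s1 \<Longrightarrow>
      (\<integral>\<^sup>+x. ennreal ((s - c + x) powr (- b1)) * indicator {c - s / 2..} x \<partial>\<mu>) \<le> ennreal (s powr (- b1))"
    using nn_integral_shifted_power_le[OF \<mu>_prob \<mu>_sets \<mu>_int c(2), of b1] b by auto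
  obtain s2 where s2: "\<And>s. s \<ge> s2 \<Longrightarrow>
      (\<integral>\<^sup>+x. ennreal ((s - c + x) powr (- b2)) * indicator {c - s / 2..} x \<partial>\<mu>) \<le> ennreal (s powr (- b2))"
    using nn_integral_shifted_power_le[OF \<mu>_prob \<mu>_sets \<mu>_int c(2), of b2] b by auto
  have G_super: "(\<integral>\<^sup>+x. ennreal (G (s - c + x)) * indicator {c - s / 2..} x \<partial>\<mu>) \<le> ennreal (G s)"
    if s: "s \<ge> max 1 (max s1 s2)" for s
    unfolding G_def
  proof (rule nn_integral_power_envelope_le[where f = \<Phi>, OF env s1 s2 \<mu>_sets])
    fix x assume "x \<in> {c - s / 2..}"
    then show "0 < s - c + x"
      using s by simp
  qed (use s in auto)

  have jump: "(\<integral>\<^sup>+x. f x * indicator {..<- y} x \<partial>\<mu>) \<le> ennreal (exp \<epsilon> * G y) * (\<integral>\<^sup>+x. f x \<partial>lborel)"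
    if y: "y \<ge> Y" and f[measurable]: "f \<in> borel_measurable borel" for y and f :: "real \<Rightarrow> ennreal"
  proof -
    define g where "g x = ennreal (\<bar>x\<bar> powr (- \<alpha> - 1) * l x)" for x
    have l_meas[measurable]: "(\<lambda>x. indicator {..x0} x * l x) \<in> borel_measurable borel"
      using l_slowly_varying by (simp add: slowly_varying_at_bot_def set_borel_measurable_def)
    have "g x * indicator {..x0} x = ennreal (\<bar>x\<bar> powr (- \<alpha> - 1) * (indicator {..x0} x * l x))" for x
      by (simp add: g_def indicator_def)
    then have g_meas: "(\<lambda>x. g x * indicator {..x0} x) \<in> borel_measurable borel"
      by simp
    have tail: "emeasure \<mu> {..x} = (\<integral>\<^sup>+y. g y * indicator {..x} y \<partial>lborel)" if "x \<le> x0" for x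
    proof -
      have "emeasure \<mu> {..x} = emeasure Q {\<omega> \<in> space Q. X \<omega> \<le> x}"
        unfolding \<mu>_def using X
        by (subst emeasure_distr) (auto intro!: arg_cong[where f = "emeasure Q"])
      then show ?thesis
        using tail_X[OF that] by (simp add: g_def)
    qed
    have "(\<integral>\<^sup>+x. f x * indicator {..<- y} x \<partial>\<mu>)
        = (\<integral>\<^sup>+x. f x * indicator {..<- y} x * indicator {..x0} x \<partial>\<mu>)"
      using y Y by (intro nn_integral_cong) (auto simp: indicator_def)
    also have "\<dots> = (\<integral>\<^sup>+x. f x * indicator {..<- y} x * (g x * indicator {..x0} x) \<partial>lborel)"
      by (rule nn_integral_tail_density[OF _ \<mu>_sets g_meas tail]) (auto intro: \<mu>.finite_measure_axioms)
    also have "\<dots> \<le> (\<integral>\<^sup>+x. ennreal (exp \<epsilon> * G y) * f x \<partial>lborel)"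
    proof (rule nn_integral_mono)
      fix x
      show "f x * indicator {..<- y} x * (g x * indicator {..x0} x) \<le> ennreal (exp \<epsilon> * G y) * f x"
      proof (cases "x < - y")
        case True
        then have "g x = ennreal (\<Phi> (- x))"
          using y Y by (simp add: g_def \<Phi>_def)
        also have "\<Phi> (- x) \<le> exp \<epsilon> * G (- x)"
          using G_ge[of "- x"] True y by (simp add: field_simps)
        also have "\<dots> \<le> exp \<epsilon> * G y"
          using True y Y by (intro mult_left_mono G_anti) auto
        finally have "g x \<le> ennreal (exp \<epsilon> * G y)"
          by (simp add: ennreal_leI)
        then have "f x * g x \<le> f x * ennreal (exp \<epsilon> * G y)"
          by (rule mult_left_mono) simp
        then show ?thesis
          using True y Y by (simp add: mult.commute indicator_def)
      qed simp
    qed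
    also have "\<dots> = ennreal (exp \<epsilon> * G y) * (\<integral>\<^sup>+x. f x \<partial>lborel)"
      by (rule nn_integral_cmult) simp
    finally show ?thesis .
  qed

  have q_le_1: "discounted_reach_prob k v \<le> 1" for k v
    by (rule discounted_reach_prob_step(1)[OF \<mu>_prob \<mu>_sets normalized]) (rule law_X[folded \<mu>_def])
  have q_step: "ennreal (discounted_reach_prob (Suc k) v) \<le> (\<integral>\<^sup>+x. ennreal (discounted_reach_prob k (v - x)) \<partial>\<mu>)"
    for k v
    by (rule discounted_reach_prob_step(2)[OF \<mu>_prob \<mu>_sets normalized]) (rule law_X[folded \<mu>_def])
  have "\<exists>K>0. \<forall>k v. v < c * real k \<longrightarrow> discounted_reach_prob k v \<le> K * G (c * real k - v)"
  proof (rule one_big_jump_bound[OF \<mu>_sets])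
    show "G (s / 4) \<le> (1 / 4) powr (- b2) * G s" if "s > 0" for s
      using G_scale[of "1 / 4" s] that by simp
    show "(\<integral>\<^sup>+x. ennreal (G (s - c + x)) * indicator {c - s / 2..} x \<partial>\<mu>) \<le> ennreal (G s)"
      if "s \<ge> max 1 (max s1 s2)" for s
      by (rule G_super[OF that])
    show "(\<integral>\<^sup>+x. f x * indicator {..<- y} x \<partial>\<mu>) \<le> ennreal (exp \<epsilon> * G y) * (\<integral>\<^sup>+x. f x \<partial>lborel)"
      if "y \<ge> Y" "f \<in> borel_measurable borel" for y and f :: "real \<Rightarrow> ennreal"
      by (rule jump[OF that])
    show "G s \<le> Cp * s powr (- b1)" if "s \<ge> 1 / 2" for s
      by (rule Cp(2)[OF that])
    show "G t \<le> G s" if "0 < s" "s \<le> t" for s t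
      by (rule G_anti[OF that])
  qed (rule measurable_discounted_reach_prob discounted_reach_prob_nonneg q_le_1 discounted_reach_prob_le_exp
    discounted_reach_prob_0 q_step c(1) b(2) Cp(1) G_pos | assumption | simp)+
  then obtain K where K: "K > 0"
    "\<And>k v. v < c * real k \<Longrightarrow> discounted_reach_prob k v \<le> K * G (c * real k - v)"
    by blast

  \<comment> \<open>For n large, c * n - v >= c * n / 2 >= \<kappa> * n, which is comparable to n.\<close>
  define \<kappa> where "\<kappa> = min 1 (c / 2)"
  have \<kappa>: "0 < \<kappa>" "\<kappa> \<le> 1" "\<kappa> \<le> c / 2"
    using c by (auto simp: \<kappa>_def)
  define a where "a = alpha_seq \<alpha> (extend x0 l)"
  have exp_a: "exp (a n) = 1 / \<Phi> (real n)" if n: "real n \<ge> Y" for n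
  proof -
    have ln: "real n > 0" "l (- real n) > 0" "extend x0 l (real n) = l (- real n)"
      using n Y x0 l_pos[of "- real n"] by (auto simp: extend_def)
    have "exp (a n) = exp ((\<alpha> + 1) * ln (real n)) / exp (ln (l (- real n)))"
      unfolding a_def alpha_seq_def ln(3) by (rule exp_diff)
    also have "\<dots> = real n powr (\<alpha> + 1) / l (- real n)"
      using ln by (simp add: powr_def)
    also have "\<dots> = 1 / \<Phi> (real n)"
    proof -
      have "real n powr (- \<alpha> - 1) = inverse (real n powr (\<alpha> + 1))"
        unfolding powr_minus[symmetric] by (rule arg_cong[where f = "(powr) (real n)"]) simp
      then show ?thesis
        using ln by (simp add: \<Phi>_def divide_inverse)
    qed
    finally show ?thesis .
  qed
  \<comment> \<open>The level a n grows only logarithmically, by the lower bound of order n powr (- b2) for \<Phi> n.\<close>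
  have "eventually (\<lambda>n. a n + 1 \<le> c * real n / 2) sequentially"
  proof -
    define C where "C = ln (2 * exp \<epsilon> / \<Phi> Y)"
    have le: "a n \<le> C + b2 * ln (real n / Y)" if n: "real n \<ge> Y" for n
    proof -
      have q: "1 \<le> real n / Y"
        using n Y by simp
      have "(Y / real n) powr (- b) = (real n / Y) powr b" for b
        using n Y by (simp add: powr_divide powr_minus field_simps)
      moreover have "(real n / Y) powr b1 \<le> (real n / Y) powr b2"
        using q b by (intro powr_mono) auto
      ultimately have "(Y / real n) powr (- b1) + (Y / real n) powr (- b2) \<le> 2 * (real n / Y) powr b2"
        by simp
      then have "exp \<epsilon> * \<Phi> (real n) * ((Y / real n) powr (- b1) + (Y / real n) powr (- b2))
          \<le> exp \<epsilon> * \<Phi> (real n) * (2 * (real n / Y) powr b2)"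
        using \<Phi>_pos[OF n] by (intro mult_left_mono) auto
      from order_trans[OF potter[OF order_refl n] this]
      have "\<Phi> Y \<le> exp \<epsilon> * \<Phi> (real n) * (2 * (real n / Y) powr b2)" .
      then have "exp (a n) \<le> 2 * exp \<epsilon> / \<Phi> Y * (real n / Y) powr b2"
        using \<Phi>_pos[OF n] \<Phi>_pos[of Y] by (simp add: exp_a[OF n] field_simps)
      also have "\<dots> = exp (C + b2 * ln (real n / Y))"
        using \<Phi>_pos[of Y] n Y by (simp add: C_def exp_add powr_def)
      finally show ?thesis
        by simp
    qed
    have "((\<lambda>x. (C + 1) / x + b2 * (ln x / x) - b2 * ln Y / x) \<longlongrightarrow> 0 + b2 * 0 - 0) at_top"
      by (intro tendsto_intros ln_x_over_x_tendsto_0 tendsto_divide_0[OF tendsto_const]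
          filterlim_at_top_imp_at_infinity filterlim_ident)
    then have "((\<lambda>x. (C + 1) / x + b2 * (ln x / x) - b2 * ln Y / x) \<longlongrightarrow> 0) at_top"
      by simp
    from order_tendstoD(2)[OF this, of "c / 2"] c
    have "eventually (\<lambda>x. (C + 1) / x + b2 * (ln x / x) - b2 * ln Y / x < c / 2) at_top"
      by simp
    then have "eventually (\<lambda>n. (C + 1) / real n + b2 * (ln (real n) / real n) - b2 * ln Y / real n < c / 2) sequentially"
      by (rule eventually_compose_filterlim[OF _ filterlim_real_sequentially])
    moreover have "eventually (\<lambda>n. real n \<ge> Y) sequentially"
      using eventually_ge_at_top[of "nat \<lceil>Y\<rceil>"] by eventually_elim linarith
    ultimately show ?thesis
    proof eventually_elim
      case (elim n)
      then have n: "real n > 0"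
        using Y by linarith
      have "a n + 1 \<le> C + 1 + b2 * ln (real n) - b2 * ln Y"
        using le[OF elim(2)] n Y by (simp add: ln_div algebra_simps)
      also have "\<dots> = ((C + 1) / real n + b2 * (ln (real n) / real n) - b2 * ln Y / real n) * real n"
        using n by (simp add: field_simps)
      also have "\<dots> \<le> c / 2 * real n"
        using elim(1) n by (intro mult_right_mono) auto
      finally show ?case
        by simp
    qed
  qed
  then obtain n1 where n1: "\<And>n. n \<ge> n1 \<Longrightarrow> a n + 1 \<le> c * real n / 2"
    by (auto simp: eventually_at_top_linorder)
  define n2 where "n2 = max n1 (nat \<lceil>Y\<rceil>)"
  have n2: "a n + 1 \<le> c * real n / 2" "real n \<ge> Y" if "n \<ge> n2" for n
  proof -
    show "a n + 1 \<le> c * real n / 2"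
      using n1[of n] that by (simp add: n2_def)
    have "nat \<lceil>Y\<rceil> \<le> n"
      using that by (simp add: n2_def)
    then show "real n \<ge> Y"
      by linarith
  qed
  define K1 where "K1 = exp 1 * K * \<kappa> powr (- b2) * 2"
  \<comment> \<open>The finitely many small n are covered by the trivial bound exp (a n - x + 1).\<close>
  define K2 where "K2 = (\<Sum>n<n2. exp (a n + 1))"
  have K12: "K1 > 0" "K2 \<ge> 0"
    using K \<kappa> by (auto simp: K1_def K2_def intro: sum_nonneg)
  have reach: "reach_prob n v = exp v * discounted_reach_prob n v" for n v
    by (simp add: discounted_reach_prob_def exp_minus)
  have bound: "reach_prob n (a n - x + 1) \<le> (K1 + K2) * exp (- x)" if x: "x \<ge> 0" for n x
  proof (cases "n \<ge> n2")
    case True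
    note n = n2[OF True]
    have n0: "real n > 0"
      using n(2) Y by linarith
    define v where "v = a n - x + 1"
    have v: "v \<le> c * real n / 2"
      using n(1) x by (simp add: v_def)
    then have v': "v < c * real n" "c * real n - v \<ge> c / 2 * real n"
      using mult_pos_pos[OF c(1) n0] by (auto simp: field_simps)
    have "G (c * real n - v) \<le> G (\<kappa> * real n)"
    proof (rule G_anti)
      show "0 < \<kappa> * real n"
        using \<kappa>(1) n0 by simp
      show "\<kappa> * real n \<le> c * real n - v"
        by (rule order_trans[OF mult_right_mono[OF \<kappa>(3)] v'(2)]) simp
    qed
    also have "\<dots> \<le> \<kappa> powr (- b2) * G (real n)"
      by (rule G_scale[OF \<kappa>(1,2) n0])
    also have "\<dots> \<le> \<kappa> powr (- b2) * (2 * \<Phi> (real n))"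
    proof (rule mult_left_mono)
      show "G (real n) \<le> 2 * \<Phi> (real n)"
        using power_envelope_le[where f = \<Phi>, OF env n(2), of "real n"] n0 by (simp add: G_def)
    qed simp
    finally have G_n: "G (c * real n - v) \<le> \<kappa> powr (- b2) * (2 * \<Phi> (real n))" .
    have "reach_prob n v \<le> exp v * (K * G (c * real n - v))"
      unfolding reach by (intro mult_left_mono K(2) v') simp
    also have "\<dots> \<le> exp v * (K * (\<kappa> powr (- b2) * (2 * \<Phi> (real n))))"
      using K(1) G_n by (intro mult_left_mono) auto
    also have "exp v = 1 / \<Phi> (real n) * exp (- x) * exp 1"
      unfolding v_def exp_a[OF n(2), symmetric] by (simp flip: exp_add)
    also have "1 / \<Phi> (real n) * exp (- x) * exp 1 * (K * (\<kappa> powr (- b2) * (2 * \<Phi> (real n)))) = K1 * exp (- x)"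
      using \<Phi>_pos[OF n(2)] by (simp add: K1_def)
    also have "\<dots> \<le> (K1 + K2) * exp (- x)"
      using K12 by (intro mult_right_mono) auto
    finally show ?thesis
      by (simp add: v_def)
  next
    case False
    have "reach_prob n (a n - x + 1) \<le> exp (a n - x + 1) * 1"
      unfolding reach by (intro mult_left_mono q_le_1) simp
    also have "\<dots> = exp (a n + 1) * exp (- x)"
      by (simp flip: exp_add)
    also have "\<dots> \<le> (K1 + K2) * exp (- x)"
    proof (rule mult_right_mono)
      have "exp (a n + 1) \<le> K2"
        unfolding K2_def using False by (intro member_le_sum) auto
      then show "exp (a n + 1) \<le> K1 + K2"
        using K12 by simp
    qed simp
    finally show ?thesis .
  qed
  show ?thesis
  proof (intro exI[of _ "K1 + K2"] conjI allI impI)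
    show "K1 + K2 > 0"
      using K12 by simp
    fix n :: nat and x :: real assume "x \<ge> 0"
    from order_trans[OF min_position_le_reach_prob bound[OF this]]
    show "measure M {\<omega> \<in> space M. min_position N D n \<omega> \<le> ereal (alpha_seq \<alpha> (extend x0 l) n - x)}
        \<le> (K1 + K2) * exp (- x)"
      by (simp add: a_def)
  qed
qed

end
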